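(* For all $n,k\geq1$: $\mathrm{RT}_{n,k}<_W\mathrm{RT}_{n,k+1}$, i.e., $\mathrm{RT}_{n,k}\leq_W\mathrm{RT}_{n,k+1}$ but $\mathrm{RT}_{n,k+1}\not\leq_W\mathrm{RT}_{n,k}$.
   Context: Weihrauch framework. A represented space is a set $X$ with a surjective partial map $\delta_X:\subseteq\mathbb{N}^{\mathbb{N}}\to X$. A problem is a partial multi-valued function $f:\subseteq X\rightrightarrows Y$; a partial $F:\subseteq\mathbb{N}^{\mathbb{N}}\to\mathbb{N}^{\mathbb{N}}$ realizes $f$ if $\delta_Y(F(p))\in f(\delta_X(p))$ whenever $\delta_X(p)\in\mathrm{dom}(f)$. With $\langle\cdot,\cdot\rangle$ a standard computable pairing on Baire space, $f\leq_W g$ means there are computable partial $H,K$ on Baire space such that $p\mapsto H\langle p,G(K(p))\rangle$ realizes $f$ for every realizer $G$ of $g$. Ramsey. $[\mathbb{N}]^n$ is the set of $n$-element subsets of $\mathbb{N}$; $k$ is identified with $\{0,\dots,k-1\}$. $\mathcal{C}_{n,k}$ is the set of colorings $c:[\mathbb{N}]^n\to k$, represented by names $p$ with $p(i)=c(\vartheta_n(i))$ for a fixed standard computable bijection $\vartheta_n:\mathbb{N}\to[\mathbb{N}]^n$. $M$ is homogeneous for $c$ if $c$ is constant on $[M]^n$. $\mathrm{RT}_{n,k}:\mathcal{C}_{n,k}\rightrightarrows2^{\mathbb{N}}$ maps $c$ to the set of characteristic functions of infinite homogeneous sets for $c$. *)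

theory Defs
  imports
    "HOL-Library.Ramsey"
    "HOL-Library.FuncSet"
    "HOL-Library.Infinite_Set"
    "HOL-Library.Nat_Bijection"
    "HOL-Library.Indicator_Function"
begin

type_synonym baire = "nat \<Rightarrow> nat"

section \<open>Computable partial functions on Baire space\<close>

text \<open>
  Programs for the partial recursive functions relative to an oracle in Baire space:
  the usual schemes of Kleene, with \<open>Query\<close> giving access to the oracle.
\<close>

datatype prog =
    Zero
  | Succ
  | Proj nat
  | Query
  | Comp prog "prog list"
  | PrimRec prog prog
  | Minim prog

text \<open>\<open>computes p e xs y\<close>: program \<open>e\<close> with oracle \<open>p\<close> halts on the arguments \<open>xs\<close> with value \<open>y\<close>.\<close>

inductive computes :: "baire \<Rightarrow> prog \<Rightarrow> nat list \<Rightarrow> nat \<Rightarrow> bool" for p :: baire where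
  Zero: "computes p Zero xs 0"
| Succ: "computes p Succ [x] (Suc x)"
| Proj: "i < length xs \<Longrightarrow> computes p (Proj i) xs (xs ! i)"
| Query: "computes p Query [x] (p x)"
| Comp: "list_all2 (\<lambda>g y. computes p g xs y) gs ys \<Longrightarrow> computes p f ys z
    \<Longrightarrow> computes p (Comp f gs) xs z"
| PrimRec_0: "computes p f xs y \<Longrightarrow> computes p (PrimRec f g) (0 # xs) y"
| PrimRec_Suc: "computes p (PrimRec f g) (m # xs) y \<Longrightarrow> computes p g (m # y # xs) z
    \<Longrightarrow> computes p (PrimRec f g) (Suc m # xs) z"
| Minim: "computes p f (m # xs) 0 \<Longrightarrow> \<forall>i<m. \<exists>y>0. computes p f (i # xs) y
    \<Longrightarrow> computes p (Minim f) xs m"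

lemma computes_deterministic:
  assumes "computes p e xs y" and "computes p e xs z"
  shows "y = z"
  using assms
proof (induction arbitrary: z rule: computes.induct)
  case (Comp xs gs ys f z z')
  from Comp.prems obtain ys' where ys': "list_all2 (\<lambda>g y. computes p g xs y) gs ys'"
    and f: "computes p f ys' z'"
    by (cases rule: computes.cases) auto
  have "ys = ys'"
    using Comp.IH(1) ys' by (auto simp: list_all2_conv_all_nth intro!: nth_equalityI)
  with Comp.IH(2) f show ?case by blast
next
  case (PrimRec_Suc f g m xs y z z')
  from PrimRec_Suc.prems show ?case
    by (cases rule: computes.cases) (use PrimRec_Suc.IH in blast)
next
  case (Minim f m xs z)
  from Minim.prems have z: "computes p f (z # xs) 0" "\<forall>i<z. \<exists>y>0. computes p f (i # xs) y"
    by (cases rule: computes.cases; auto)+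
  show ?case
  proof (rule linorder_cases[of m z])
    assume "m < z"
    then obtain y where "y > 0" "computes p f (m # xs) y" using z(2) by blast
    with Minim.IH(1) show ?thesis by fastforce
  next
    assume "z < m"
    with Minim.IH(2) z(1) show ?thesis by fastforce
  qed
qed (erule computes.cases; fastforce)+

text \<open>
  A computable function need not have the maximal domain on which its program yields a total
  output.  This convention has no influence on Weihrauch reducibility, as extending the two
  reduction functions to their maximal domains preserves reductions.
\<close>

definition computable :: "(baire \<rightharpoonup> baire) \<Rightarrow> bool" where
  "computable F \<longleftrightarrow> (\<exists>e. \<forall>p q. F p = Some q \<longrightarrow> (\<forall>i. computes p e [i] (q i)))"

definition pair :: "baire \<Rightarrow> baire \<Rightarrow> baire" where
  "pair p q = (\<lambda>i. if even i then p (i div 2) else q (i div 2))"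

section \<open>Problems and Weihrauch reducibility\<close>

text \<open>
  A represented space is given by its representation \<open>\<delta>\<close>; its underlying set is \<open>ran \<delta>\<close>, onto
  which \<open>\<delta>\<close> is surjective.
\<close>

type_synonym 'a representation = "baire \<rightharpoonup> 'a"

text \<open>
  A partial multi-valued function is given by the set of solutions of each instance; its domain
  consists of the instances with at least one solution.
\<close>

record ('a, 'b) problem =
  in_rep :: "'a representation"
  out_rep :: "'b representation"
  sols :: "'a \<Rightarrow> 'b set"

definition realizes :: "(baire \<rightharpoonup> baire) \<Rightarrow> ('a, 'b) problem \<Rightarrow> bool" where
  "realizes F f \<longleftrightarrow>
    (\<forall>p x. in_rep f p = Some x \<and> sols f x \<noteq> {} \<longrightarrow>
      (\<exists>q y. F p = Some q \<and> out_rep f q = Some y \<and> y \<in> sols f x))"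

definition weihrauch_le :: "('a, 'b) problem \<Rightarrow> ('c, 'd) problem \<Rightarrow> bool"
    (infix \<open>\<le>\<^sub>W\<close> 50) where
  "f \<le>\<^sub>W g \<longleftrightarrow>
    (\<exists>H K. computable H \<and> computable K \<and>
      (\<forall>G. realizes G g \<longrightarrow>
        realizes (\<lambda>p. Option.bind (K p) (\<lambda>r. Option.bind (G r) (\<lambda>s. H (pair p s)))) f))"

definition weihrauch_less :: "('a, 'b) problem \<Rightarrow> ('c, 'd) problem \<Rightarrow> bool"
    (infix \<open><\<^sub>W\<close> 50) where
  "f <\<^sub>W g \<longleftrightarrow> f \<le>\<^sub>W g \<and> \<not> g \<le>\<^sub>W f"

section \<open>Ramsey's theorem as a problem\<close>

definition colorings :: "nat \<Rightarrow> nat \<Rightarrow> (nat set \<Rightarrow> nat) set" where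
  "colorings n k = nsets UNIV n \<rightarrow>\<^sub>E {..<k}"

text \<open>
  The \<open>n\<close>-element sets of natural numbers, listed in increasing order of their binary codes
  (that is, in colexicographic order).
\<close>

definition theta :: "nat \<Rightarrow> nat \<Rightarrow> nat set" where
  "theta n i = set_decode (enumerate {m. card (set_decode m) = n} i)"

lemma bij_betw_theta:
  assumes "n \<ge> 1"
  shows "bij_betw (theta n) UNIV (nsets UNIV n)"
proof -
  let ?C = "{m. card (set_decode m) = n}"
  have bij: "bij_betw set_decode ?C (nsets UNIV n)"
    by (rule bij_betw_byWitness[where f' = set_encode]) (auto simp: nsets_def)
  have "inj (\<lambda>m::nat. {m..<m + n})"
    using assms by (intro injI) (auto dest: atLeastLessThan_inj(1))
  moreover have "range (\<lambda>m::nat. {m..<m + n}) \<subseteq> nsets UNIV n"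
    by (auto simp: nsets_def)
  ultimately have "infinite (nsets (UNIV :: nat set) n)"
    using infinite_super range_inj_infinite by blast
  then have "infinite ?C"
    using bij bij_betw_finite by blast
  then have "bij_betw (enumerate ?C) UNIV ?C"
    by (rule bij_enumerate)
  from bij_betw_trans[OF this bij] show ?thesis
    by (simp add: theta_def[abs_def] comp_def)
qed

definition coloring_rep :: "nat \<Rightarrow> nat \<Rightarrow> (nat set \<Rightarrow> nat) representation" where
  "coloring_rep n k p =
    (if \<exists>c\<in>colorings n k. \<forall>i. p i = c (theta n i)
     then Some (THE c. c \<in> colorings n k \<and> (\<forall>i. p i = c (theta n i)))
     else None)"

lemma coloring_rep_eq_Some_iff:
  assumes "n \<ge> 1"
  shows "coloring_rep n k p = Some c \<longleftrightarrow> c \<in> colorings n k \<and> (\<forall>i. p i = c (theta n i))"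
proof -
  have unique: "c = d"
    if "c \<in> colorings n k" "d \<in> colorings n k"
      and "\<forall>i. p i = c (theta n i)" "\<forall>i. p i = d (theta n i)" for c d
  proof (rule PiE_ext)
    show "c \<in> nsets UNIV n \<rightarrow>\<^sub>E {..<k}" "d \<in> nsets UNIV n \<rightarrow>\<^sub>E {..<k}"
      using that by (simp_all add: colorings_def)
    show "c s = d s" if "s \<in> nsets UNIV n" for s
    proof -
      from that obtain i where "s = theta n i"
        using bij_betw_theta[OF assms] by (auto simp: bij_betw_def)
      with \<open>\<forall>i. p i = c (theta n i)\<close> \<open>\<forall>i. p i = d (theta n i)\<close> show ?thesis
        by metis
    qed
  qed
  have the: "(THE c. c \<in> colorings n k \<and> (\<forall>i. p i = c (theta n i))) = c"
    if "c \<in> colorings n k" "\<forall>i. p i = c (theta n i)" for c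
    using that unique by (intro the_equality) blast+
  show ?thesis
  proof (cases "\<exists>d\<in>colorings n k. \<forall>i. p i = d (theta n i)")
    case True
    then obtain d where d: "d \<in> colorings n k" "\<forall>i. p i = d (theta n i)" by blast
    have "coloring_rep n k p = Some d"
      unfolding coloring_rep_def the[OF d] using True by simp
    then show ?thesis using d unique by auto
  next
    case False
    then show ?thesis unfolding coloring_rep_def by auto
  qed
qed

lemma ran_coloring_rep:
  assumes "n \<ge> 1"
  shows "ran (coloring_rep n k) = colorings n k"
proof -
  have "coloring_rep n k (\<lambda>i. c (theta n i)) = Some c" if "c \<in> colorings n k" for c
    using that by (simp add: coloring_rep_eq_Some_iff[OF assms])
  then show ?thesis
    unfolding ran_def by (auto simp: coloring_rep_eq_Some_iff[OF assms])
qed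

text \<open>Cantor space, a subspace of Baire space.\<close>

definition cantor_rep :: "baire representation" where
  "cantor_rep p = (if range p \<subseteq> {0, 1} then Some p else None)"

definition homogeneous :: "nat \<Rightarrow> (nat set \<Rightarrow> nat) \<Rightarrow> nat set \<Rightarrow> bool" where
  "homogeneous n c M \<longleftrightarrow> (\<exists>j. \<forall>s\<in>nsets M n. c s = j)"

definition RT :: "nat \<Rightarrow> nat \<Rightarrow> (nat set \<Rightarrow> nat, baire) problem" where
  "RT n k =
    \<lparr>in_rep = coloring_rep n k,
     out_rep = cantor_rep,
     sols = (\<lambda>c. {indicator M |M. c \<in> colorings n k \<and> infinite M \<and> homogeneous n c M})\<rparr>"

end

theory Submission
  imports Defs "HOL-Analysis.Function_Topology" "HOL-Library.Countable_Set"
begin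

text \<open>
  The negative part only uses that computable functions are continuous. A reduction of \<open>RT n l\<close> to
  \<open>RT n k\<close> yields a compact set of triples of an \<open>l\<close>-coloring \<open>p\<close>, a \<open>k\<close>-coloring \<open>d\<close> and some advice
  such that every \<open>p\<close> occurs and every infinite homogeneous set of \<open>d\<close> determines, through finitely
  many bits, a color in which \<open>p\<close> has an infinite homogeneous set.

  Such a set for \<open>n + 1\<close> yields one for \<open>n\<close>: a coloring \<open>q\<close> of \<open>n\<close>-sets is turned into colorings \<open>p\<close> with
  \<open>p (insert y s) \<longlonglongrightarrow> q s\<close> as \<open>y\<close> grows, built by finite extensions which also decide, for each
  finite list of conditions \<open>d (insert y s) = j\<close>, how far one has to search for a solution \<open>y\<close>. So the
  sequences that are prehomogeneous for \<open>d\<close> form a compact set depending continuously on \<open>q\<close>, and they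
  serve as additional advice.

  For \<open>n = 1\<close> and \<open>l = k + 1\<close>, each color \<open>j\<close> of \<open>d\<close> is diagonalized by waiting until the \<open>j\<close>-colored
  elements commit to a color \<open>i\<close> of \<open>p\<close> and never using \<open>i\<close> again; \<open>k + 1\<close> colors suffice for this.
\<close>

section \<open>Compactness in products of the natural numbers\<close>

text \<open>Since \<open>nat\<close> is discrete, the sets \<open>{w. agrees G z w}\<close> with
  finite \<open>G\<close> are the basic neighbourhoods of \<open>z\<close> in the product.\<close>

definition agrees :: "'a set \<Rightarrow> ('a \<Rightarrow> nat) \<Rightarrow> ('a \<Rightarrow> nat) \<Rightarrow> bool" where
  "agrees G z w \<longleftrightarrow> (\<forall>x\<in>G. w x = z x)"

lemma agrees_refl [simp]: "agrees G z z"
  by (simp add: agrees_def)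

lemma agreesD: "agrees G z w \<Longrightarrow> x \<in> G \<Longrightarrow> w x = z x"
  by (simp add: agrees_def)

lemma agrees_mono: "agrees G z w \<Longrightarrow> G' \<subseteq> G \<Longrightarrow> agrees G' z w"
  by (auto simp: agrees_def)

lemma open_coordinate: "open {w :: 'a \<Rightarrow> nat. w x \<in> S}"
proof -
  have "open ((\<lambda>w :: 'a \<Rightarrow> nat. w x) -` S)"
    by (rule open_vimage[OF open_discrete continuous_on_product_coordinates])
  then show ?thesis by (simp add: vimage_def)
qed

lemma closed_coordinate: "closed {w :: 'a \<Rightarrow> nat. w x \<in> S}"
  using open_coordinate[of x "- S"] by (simp add: closed_def Collect_neg_eq[symmetric] Compl_eq)

lemma open_agrees:
  assumes "finite G"
  shows "open {w. agrees G z w}"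
proof -
  have eq: "{w. agrees G z w} = (\<Inter>x\<in>G. {w. w x \<in> {z x}})"
    by (auto simp: agrees_def)
  show ?thesis
    unfolding eq using assms by (intro open_INT ballI open_coordinate)
qed

lemma closed_agrees: "closed {w. agrees G z w}"
proof -
  have eq: "{w. agrees G z w} = (\<Inter>x\<in>G. {w. w x \<in> {z x}})"
    by (auto simp: agrees_def)
  show ?thesis
    unfolding eq by (intro closed_INT ballI closed_coordinate)
qed

lemma open_fun_nat_iff:
  fixes U :: "('a \<Rightarrow> nat) set"
  shows "open U \<longleftrightarrow> (\<forall>z\<in>U. \<exists>G. finite G \<and> (\<forall>w. agrees G z w \<longrightarrow> w \<in> U))"
proof
  assume U: "open U"
  show "\<forall>z\<in>U. \<exists>G. finite G \<and> (\<forall>w. agrees G z w \<longrightarrow> w \<in> U)"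
  proof
    fix z assume "z \<in> U"
    with U obtain V where V: "finite {i. V i \<noteq> UNIV}" "z \<in> Pi\<^sub>E UNIV V" "Pi\<^sub>E UNIV V \<subseteq> U"
      unfolding open_fun_def openin_product_topology_alt by auto
    have "w \<in> U" if "agrees {i. V i \<noteq> UNIV} z w" for w
    proof -
      have "w i \<in> V i" for i
        using that V(2) by (cases "V i = UNIV") (auto simp: agrees_def PiE_def Pi_def)
      then show ?thesis using V(3) by auto
    qed
    then show "\<exists>G. finite G \<and> (\<forall>w. agrees G z w \<longrightarrow> w \<in> U)" using V(1) by blast
  qed
next
  assume R: "\<forall>z\<in>U. \<exists>G. finite G \<and> (\<forall>w. agrees G z w \<longrightarrow> w \<in> U)"
  show "open U"
  proof (subst open_subopen, intro ballI)
    fix z assume "z \<in> U"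
    with R obtain G where "finite G" "\<forall>w. agrees G z w \<longrightarrow> w \<in> U" by blast
    then show "\<exists>T. open T \<and> z \<in> T \<and> T \<subseteq> U"
      by (intro exI[of _ "{w. agrees G z w}"]) (auto intro: open_agrees)
  qed
qed

lemma closed_fun_natI:
  fixes E :: "('a \<Rightarrow> nat) set"
  assumes "\<And>z. z \<notin> E \<Longrightarrow> \<exists>G. finite G \<and> (\<forall>w. agrees G z w \<longrightarrow> w \<notin> E)"
  shows "closed E"
  using assms unfolding closed_def open_fun_nat_iff by auto

lemma closed_fun_natD:
  fixes E :: "('a \<Rightarrow> nat) set"
  assumes "closed E" "z \<notin> E"
  obtains G where "finite G" "\<And>w. agrees G z w \<Longrightarrow> w \<notin> E"
  using assms unfolding closed_def open_fun_nat_iff by auto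

text \<open>By Tychonoff the box of the finite sets \<open>{..b x}\<close> is compact, and
  \<open>E\<close> is a closed part of it.\<close>

lemma compact_fun_natI:
  fixes E :: "('a \<Rightarrow> nat) set"
  assumes "closed E" and "\<And>x. \<exists>b. \<forall>z\<in>E. z x \<le> b"
  shows "compact E"
proof -
  obtain b where b: "\<And>x z. z \<in> E \<Longrightarrow> z x \<le> b x"
    using assms(2) by metis
  let ?B = "Pi\<^sub>E UNIV (\<lambda>x. {..b x})"
  have "compactin (product_topology (\<lambda>i. euclidean) UNIV) ?B"
    unfolding compactin_PiE by (auto intro: finite_imp_compact)
  then have "compact ?B"
    by (simp add: euclidean_product_topology)
  moreover have "E = E \<inter> ?B" using b by auto
  ultimately show ?thesis
    using closed_Int_compact[OF assms(1)] by metis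
qed

text \<open>Each point of \<open>E\<close> differs from an outside point \<open>z\<close> at some
  coordinate. By compactness finitely many coordinates suffice, and agreeing with \<open>z\<close>
  on all of them keeps a point out of \<open>E\<close>.\<close>

lemma compact_fun_nat_imp_closed:
  fixes E :: "('a \<Rightarrow> nat) set"
  assumes "compact E"
  shows "closed E"
proof (rule closed_fun_natI)
  fix z assume z: "z \<notin> E"
  have "open {w :: 'a \<Rightarrow> nat. w x \<in> - {z x}}" for x
    by (rule open_coordinate)
  moreover have "E \<subseteq> (\<Union>x. {w. w x \<in> - {z x}})"
    using z by (auto simp: fun_eq_iff) (metis ext)
  ultimately obtain C where C: "C \<subseteq> UNIV" "finite C" "E \<subseteq> (\<Union>x\<in>C. {w. w x \<in> - {z x}})"
    by (rule compactE_image[OF assms])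
  then show "\<exists>G. finite G \<and> (\<forall>w. agrees G z w \<longrightarrow> w \<notin> E)"
    by (intro exI[of _ C]) (auto simp: agrees_def)
qed

lemma compact_coordinate_bounded:
  fixes E :: "('a \<Rightarrow> nat) set"
  assumes "compact E"
  obtains b where "\<And>z. z \<in> E \<Longrightarrow> z x \<le> b"
proof -
  have "open {z :: 'a \<Rightarrow> nat. z x \<in> {..b}}" for b
    by (rule open_coordinate)
  moreover have "E \<subseteq> (\<Union>b. {z. z x \<in> {..b}})"
    by auto
  ultimately obtain C where C: "finite C" "E \<subseteq> (\<Union>b\<in>C. {z. z x \<in> {..b}})"
    using compactE_image[OF assms, of UNIV "\<lambda>b. {z. z x \<in> {..b}}"] by metis
  have "z x \<le> Max C" if "z \<in> E" for z
  proof -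
    from that C(2) obtain b where "b \<in> C" "z x \<le> b" by auto
    with C(1) show ?thesis by (meson Max_ge order_trans)
  qed
  then show ?thesis using that by blast
qed

section \<open>Selectors\<close>

type_synonym config = "nat \<times> nat set \<Rightarrow> nat"

definition slice :: "config \<Rightarrow> nat \<Rightarrow> nat set \<Rightarrow> nat" where
  "slice z i = (\<lambda>s. z (i, s))"

text \<open>The default off the \<open>n\<close>-sets is 0 instead of \<open>undefined\<close>, so
  that every coordinate is below \<open>l\<close> and compactness is immediate.\<close>

definition Col :: "nat \<Rightarrow> nat \<Rightarrow> (nat set \<Rightarrow> nat) set" where
  "Col n l = {c. \<forall>s. c s < l \<and> (s \<notin> nsets UNIV n \<longrightarrow> c s = 0)}"

definition has_homogeneous :: "nat \<Rightarrow> nat \<Rightarrow> (nat set \<Rightarrow> nat) \<Rightarrow> bool" where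
  "has_homogeneous n i c \<longleftrightarrow> (\<exists>S. infinite S \<and> (\<forall>s\<in>nsets S n. c s = i))"

text \<open>A compact relaxation of a reduction to \<open>RT n k\<close>: slice 0 of a configuration is the coloring to
  be solved, slice 1 the instance of \<open>RT n k\<close> it is mapped to, and the remaining slices are arbitrary
  advice. Of the answer only the color is kept, and it must be read off finitely many coordinates.\<close>

definition selector :: "nat \<Rightarrow> nat \<Rightarrow> nat \<Rightarrow> config set \<Rightarrow> bool" where
  "selector n l k E \<longleftrightarrow>
    compact E \<and>
    (\<forall>z\<in>E. slice z 0 \<in> Col n l \<and> slice z 1 \<in> Col n k) \<and>
    (\<forall>c\<in>Col n l. \<exists>z\<in>E. slice z 0 = c) \<and>
    (\<forall>z\<in>E. \<forall>M. infinite M \<and> homogeneous n (slice z 1) M \<longrightarrow>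
      (\<exists>i G m. finite G \<and>
        (\<forall>w\<in>E. \<forall>N. infinite N \<and> homogeneous n (slice w 1) N \<and> agrees G z w \<and> N \<inter> {..m} = M \<inter> {..m}
          \<longrightarrow> has_homogeneous n i (slice w 0))))"

lemma ColD: "c \<in> Col n l \<Longrightarrow> c s < l" "c \<in> Col n l \<Longrightarrow> s \<notin> nsets UNIV n \<Longrightarrow> c s = 0"
  by (auto simp: Col_def)

lemma Col_infinite_eq_0: "c \<in> Col n l \<Longrightarrow> infinite s \<Longrightarrow> c s = 0"
  by (auto simp: Col_def nsets_def)

lemma closed_slice_Col: "closed {z. slice z i \<in> Col n l}"
proof -
  have eq: "{z. slice z i \<in> Col n l} =
    (\<Inter>s. {z. z (i, s) \<in> {v. v < l \<and> (s \<notin> nsets UNIV n \<longrightarrow> v = 0)}})"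
    by (auto simp: Col_def slice_def)
  show ?thesis
    unfolding eq by (intro closed_INT ballI closed_coordinate)
qed

lemma compact_Col: "compact (Col n l)"
proof (rule compact_fun_natI)
  have eq: "Col n l = (\<Inter>s. {c. c s \<in> {v. v < l \<and> (s \<notin> nsets UNIV n \<longrightarrow> v = 0)}})"
    by (auto simp: Col_def)
  show "closed (Col n l)"
    unfolding eq by (intro closed_INT ballI closed_coordinate)
  show "\<exists>b. \<forall>z\<in>Col n l. z x \<le> b" for x
    by (intro exI[of _ l]) (auto dest: ColD(1) less_imp_le)
qed

text \<open>The conditions \<open>slice z i s = f s\<close> have the finite intersection property on
  \<open>E\<close>; hence projections of compact sets are closed.\<close>

lemma slice_projection_closed:
  assumes "compact E" and "\<And>G. finite G \<Longrightarrow> \<exists>z\<in>E. \<forall>s\<in>G. slice z i s = f s"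
  shows "\<exists>z\<in>E. slice z i = f"
proof -
  let ?A = "\<lambda>s. {z. z (i, s) \<in> {f s}}"
  have "E \<inter> \<Inter> (range ?A) \<noteq> {}"
  proof (rule compact_imp_fip_image[OF assms(1)])
    show "closed (?A s)" for s by (rule closed_coordinate)
    show "E \<inter> \<Inter> (?A ` I) \<noteq> {}" if "finite I" for I
      using assms(2)[OF that] by (auto simp: slice_def)
  qed
  then show ?thesis by (auto simp: slice_def fun_eq_iff)
qed

section \<open>Colorings of singletons\<close>

lemma closed_slice_family: "closed {z. slice z i \<in> {c. \<forall>s. c s \<in> P s}}"
proof -
  have eq: "{z. slice z i \<in> {c. \<forall>s. c s \<in> P s}} = (\<Inter>s. {z. z (i, s) \<in> P s})"
    by (auto simp: slice_def)
  show ?thesis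
    unfolding eq by (intro closed_INT ballI closed_coordinate)
qed

lemma finite_sets_bounded:
  fixes G :: "nat set set"
  assumes "finite G"
  obtains m' where "m \<le> m'" "\<And>s. s \<in> G \<Longrightarrow> finite s \<Longrightarrow> s \<subseteq> {..<m'}"
proof -
  have "finite (\<Union>{s \<in> G. finite s})"
    using assms by auto
  then obtain b where "\<Union>{s \<in> G. finite s} \<subseteq> {..<b}"
    using finite_nat_bounded by blast
  then have "s \<subseteq> {..<max m b}" if "s \<in> G" "finite s" for s
    using that by fastforce
  then show ?thesis using that[of "max m b"] by simp
qed

text \<open>As the projection of \<open>E\<close> is closed, finitely many coordinates keep
  \<open>f\<close> away from it. Infinite sets among them can be ignored, because all colorings
  vanish there, and the finite ones lie below some \<open>m'\<close>.\<close>

lemma slice_projection_avoid: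
  assumes "compact E" "f \<in> Col n l" "\<forall>z\<in>E. slice z 0 \<noteq> f"
  obtains m' where "m \<le> m'"
    "\<And>p z. p \<in> Col n l \<Longrightarrow> \<forall>s. s \<subseteq> {..<m'} \<longrightarrow> p s = f s \<Longrightarrow> z \<in> E \<Longrightarrow> slice z 0 \<noteq> p"
proof -
  have "\<exists>G. finite G \<and> (\<forall>z\<in>E. \<exists>s\<in>G. slice z 0 s \<noteq> f s)"
  proof (rule ccontr)
    assume "\<not> ?thesis"
    then have "\<exists>z\<in>E. \<forall>s\<in>G. slice z 0 s = f s" if "finite G" for G
      using that by auto
    from slice_projection_closed[OF assms(1) this] assms(3) show False by auto
  qed
  then obtain G where G: "finite G" "\<forall>z\<in>E. \<exists>s\<in>G. slice z 0 s \<noteq> f s"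
    by blast
  obtain m' where m': "m \<le> m'" "\<And>s. s \<in> G \<Longrightarrow> finite s \<Longrightarrow> s \<subseteq> {..<m'}"
    using finite_sets_bounded[OF G(1)] by blast
  have "slice z 0 \<noteq> p" if "p \<in> Col n l" "\<forall>s. s \<subseteq> {..<m'} \<longrightarrow> p s = f s" "z \<in> E" for p z
  proof -
    from G(2) that(3) obtain s where "s \<in> G" "slice z 0 s \<noteq> f s" by blast
    moreover have "p s = f s" if "s \<in> G"
      using m'(2)[OF that] \<open>\<forall>s. s \<subseteq> {..<m'} \<longrightarrow> p s = f s\<close> Col_infinite_eq_0[OF \<open>p \<in> Col n l\<close>, of s]
        Col_infinite_eq_0[OF assms(2), of s] by (cases "finite s") auto
    ultimately show ?thesis by metis
  qed
  with m'(1) show ?thesis using that by blast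
qed

section \<open>Cylinders of 1-colorings and a Baire category argument\<close>

definition Ext1 :: "nat \<Rightarrow> nat \<Rightarrow> (nat set \<Rightarrow> nat) \<Rightarrow> nat set \<Rightarrow> (nat set \<Rightarrow> nat) set" where
  "Ext1 l m f A = {p \<in> Col 1 l. (\<forall>s. s \<subseteq> {..<m} \<longrightarrow> p s = f s) \<and> (\<forall>x\<ge>m. p {x} \<in> A)}"

lemma closed_slice_Ext1: "closed {z. slice z i \<in> Ext1 l m f A}"
proof -
  have eq: "Ext1 l m f A = {c. \<forall>s. c s \<in> {v. v < l \<and> (s \<notin> nsets UNIV 1 \<longrightarrow> v = 0) \<and>
      (s \<subseteq> {..<m} \<longrightarrow> v = f s) \<and> (\<forall>x\<ge>m. s = {x} \<longrightarrow> v \<in> A)}}"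
    by (auto simp: Ext1_def Col_def)
  show ?thesis unfolding eq by (rule closed_slice_family)
qed

lemma Ext1_mono:
  assumes "f' \<in> Ext1 l m f A" "m \<le> m'" "A' \<subseteq> A"
  shows "Ext1 l m' f' A' \<subseteq> Ext1 l m f A"
proof
  fix p assume p: "p \<in> Ext1 l m' f' A'"
  have "p s = f s" if "s \<subseteq> {..<m}" for s
  proof -
    have "s \<subseteq> {..<m'}" using that assms(2) by auto
    then show ?thesis using p assms(1) that by (simp add: Ext1_def)
  qed
  moreover have "p {x} \<in> A" if "x \<ge> m" for x
  proof (cases "x < m'")
    case True
    then have "{x} \<subseteq> {..<m'}" by simp
    then have "p {x} = f' {x}" using p by (simp add: Ext1_def)
    then show ?thesis using assms(1) that by (simp add: Ext1_def)
  next
    case False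
    then show ?thesis using p assms(3) by (auto simp: Ext1_def)
  qed
  ultimately show "p \<in> Ext1 l m f A" using p by (simp add: Ext1_def)
qed

text \<open>A finite form of the Baire category theorem: a piece that does not project onto the
  whole cylinder misses a smaller cylinder, on which the remaining pieces must suffice.\<close>

lemma Ext1_cover:
  assumes "finite I" "\<And>i. i \<in> I \<Longrightarrow> compact (E i)" "f \<in> Ext1 l m f A"
    "\<forall>p\<in>Ext1 l m f A. \<exists>i\<in>I. \<exists>z\<in>E i. slice z 0 = p"
  shows "\<exists>i\<in>I. \<exists>m'\<ge>m. \<exists>f'\<in>Ext1 l m f A. f' \<in> Ext1 l m' f' A \<and>
    (\<forall>p\<in>Ext1 l m' f' A. \<exists>z\<in>E i. slice z 0 = p)"
  using assms
proof (induction I arbitrary: m f rule: finite_induct)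
  case empty
  then show ?case by blast
next
  case (insert i I)
  show ?case
  proof (cases "\<forall>p\<in>Ext1 l m f A. \<exists>z\<in>E i. slice z 0 = p")
    case True
    then show ?thesis using insert.prems(2) by blast
  next
    case False
    then obtain f' where f': "f' \<in> Ext1 l m f A" "\<forall>z\<in>E i. slice z 0 \<noteq> f'" by blast
    then have "f' \<in> Col 1 l" by (simp add: Ext1_def)
    from slice_projection_avoid[OF insert.prems(1)[of i] this f'(2), of m]
    obtain m' where m': "m \<le> m'" "\<And>p z. p \<in> Col 1 l \<Longrightarrow>
        \<forall>s. s \<subseteq> {..<m'} \<longrightarrow> p s = f' s \<Longrightarrow> z \<in> E i \<Longrightarrow> slice z 0 \<noteq> p"
      by blast
    have sub: "Ext1 l m' f' A \<subseteq> Ext1 l m f A"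
      by (rule Ext1_mono[OF f'(1) m'(1)]) simp
    have mem: "f' \<in> Ext1 l m' f' A"
      using f'(1) m'(1) by (auto simp: Ext1_def)
    have "\<forall>p\<in>Ext1 l m' f' A. \<exists>i\<in>I. \<exists>z\<in>E i. slice z 0 = p"
    proof
      fix p assume p: "p \<in> Ext1 l m' f' A"
      with sub insert.prems(3) obtain j z where j: "j \<in> insert i I" "z \<in> E j" "slice z 0 = p"
        by blast
      moreover have "j \<noteq> i"
        using m'(2)[of p z] p j by (auto simp: Ext1_def)
      ultimately show "\<exists>i\<in>I. \<exists>z\<in>E i. slice z 0 = p" by blast
    qed
    with insert.IH[OF insert.prems(1) mem]
    obtain j m'' f'' where "j \<in> I" "m'' \<ge> m'" "f'' \<in> Ext1 l m' f' A" "f'' \<in> Ext1 l m'' f'' A"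
      "\<forall>p\<in>Ext1 l m'' f'' A. \<exists>z\<in>E j. slice z 0 = p"
      by auto
    then show ?thesis using sub m'(1) by (meson insertCI order_trans subsetD)
  qed
qed

lemma Ext1_obtain:
  assumes "f \<in> Col 1 l" "a \<in> A" "a < l"
  obtains f' where "f' \<in> Ext1 l m f A"
proof
  let ?f = "\<lambda>s. if s \<in> nsets UNIV 1 \<and> \<not> s \<subseteq> {..<m} then a else f s"
  show "?f \<in> Ext1 l m f A"
    using assms by (auto simp: Ext1_def Col_def nsets_def)
qed

lemma has_homogeneous_1_iff: "has_homogeneous 1 i c \<longleftrightarrow> infinite {x. c {x} = i}"
proof
  assume "has_homogeneous 1 i c"
  then obtain S where S: "infinite S" "\<forall>s\<in>nsets S 1. c s = i"
    by (auto simp: has_homogeneous_def)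
  then have "S \<subseteq> {x. c {x} = i}" by (auto simp: nsets_one)
  with S(1) show "infinite {x. c {x} = i}" using infinite_super by blast
next
  assume "infinite {x. c {x} = i}"
  then show "has_homogeneous 1 i c"
    unfolding has_homogeneous_def by (intro exI[of _ "{x. c {x} = i}"]) (auto simp: nsets_one)
qed

lemma Col_1_colour_infinite:
  assumes "d \<in> Col 1 k"
  obtains j where "j < k" "infinite {x. d {x} = j}"
proof -
  have "finite ((\<lambda>x. d {x}) ` UNIV)"
    by (rule finite_subset[of _ "{..<k}"]) (use ColD(1)[OF assms] in auto)
  then obtain x where "infinite {a \<in> UNIV. d {a} = d {x}}"
    using pigeonhole_infinite[of UNIV "\<lambda>x. d {x}"] by auto
  then show ?thesis using that[of "d {x}"] ColD(1)[OF assms] by auto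
qed

lemma selector_commit:
  assumes "selector n l k E" "z \<in> E" "infinite M" "homogeneous n (slice z 1) M"
  obtains i G m where "finite G" "\<And>w N. w \<in> E \<Longrightarrow> infinite N \<Longrightarrow> homogeneous n (slice w 1) N \<Longrightarrow>
    agrees G z w \<Longrightarrow> N \<inter> {..m} = M \<inter> {..m} \<Longrightarrow> has_homogeneous n i (slice w 0)"
proof -
  from assms(1) have "\<forall>z\<in>E. \<forall>M. infinite M \<and> homogeneous n (slice z 1) M \<longrightarrow>
      (\<exists>i G m. finite G \<and>
        (\<forall>w\<in>E. \<forall>N. infinite N \<and> homogeneous n (slice w 1) N \<and> agrees G z w \<and> N \<inter> {..m} = M \<inter> {..m}
          \<longrightarrow> has_homogeneous n i (slice w 0)))"
    unfolding selector_def by (elim conjE)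
  from this[rule_format, OF assms(2) conjI[OF assms(3,4)]] obtain i G m where G: "finite G"
    and *: "\<forall>w\<in>E. \<forall>N. infinite N \<and> homogeneous n (slice w 1) N \<and> agrees G z w \<and> N \<inter> {..m} = M \<inter> {..m}
          \<longrightarrow> has_homogeneous n i (slice w 0)"
    by (elim exE conjE)
  show ?thesis
    by (rule that[OF G]) (use * in blast)
qed

text \<open>The full color class serves as the homogeneous set. Its part up to \<open>m\<close> is
  itself given by coordinates of slice 1, so the commitment can be expressed by finitely many
  coordinates alone.\<close>

lemma selector_1_commit:
  assumes "selector 1 l k E" "z \<in> E" "infinite {x. slice z 1 {x} = j}"
  obtains i G where "finite G" "\<And>w. w \<in> E \<Longrightarrow> agrees G z w \<Longrightarrow> infinite {x. slice w 1 {x} = j} \<Longrightarrow>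
    infinite {x. slice w 0 {x} = i}"
proof -
  have hom: "homogeneous 1 (slice w 1) {x. slice w 1 {x} = j}" for w
    by (auto simp: homogeneous_def nsets_one)
  obtain i G m where G: "finite G" and commit: "\<And>w N. w \<in> E \<Longrightarrow> infinite N \<Longrightarrow>
      homogeneous 1 (slice w 1) N \<Longrightarrow> agrees G z w \<Longrightarrow>
      N \<inter> {..m} = {x. slice z 1 {x} = j} \<inter> {..m} \<Longrightarrow> has_homogeneous 1 i (slice w 0)"
    by (rule selector_commit[OF assms hom]) blast
  let ?G = "G \<union> (\<lambda>x. (1, {x})) ` {..m}"
  have "infinite {x. slice w 0 {x} = i}"
    if w: "w \<in> E" "agrees ?G z w" "infinite {x. slice w 1 {x} = j}" for w
  proof -
    have "{x. slice w 1 {x} = j} \<inter> {..m} = {x. slice z 1 {x} = j} \<inter> {..m}"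
      using w(2) by (auto simp: agrees_def slice_def)
    moreover have "agrees G z w" using w(2) by (rule agrees_mono) simp
    ultimately have "has_homogeneous 1 i (slice w 0)"
      using commit[OF w(1,3) hom] by blast
    then show ?thesis unfolding has_homogeneous_1_iff .
  qed
  moreover have "finite ?G" using G by simp
  ultimately show ?thesis using that by blast
qed

text \<open>\<open>A\<close> holds the colors still allowed for slice 0, and \<open>J\<close> the colors of slice 1 that have been
  made finite. A piece of the configurations on which the \<open>j\<close>-colored set leads to answer \<open>i\<close>
  projects onto a whole cylinder; forbidding \<open>i\<close> from there on makes \<open>j\<close> finite.\<close>

lemma selector_1_stage:
  assumes sel: "selector 1 l k E"
    and "E' \<subseteq> E" "compact E'" "f \<in> Ext1 l m f A" "finite A" "A \<subseteq> {..<l}" "J \<subseteq> {..<k}"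
    and "card A + card J \<ge> Suc k"
    and "\<forall>p\<in>Ext1 l m f A. \<exists>z\<in>E'. slice z 0 = p"
    and "\<forall>z\<in>E'. slice z 0 \<in> Ext1 l m f A \<longrightarrow> (\<forall>j\<in>J. finite {x. slice z 1 {x} = j})"
  shows False
  using assms(2-)
proof (induction "k - card J" arbitrary: E' m f A J rule: less_induct)
  case less
  have finJ: "finite J" using less.prems(6) finite_subset by blast
  define Z where "Z = E' \<inter> {z. slice z 0 \<in> Ext1 l m f A}"
  have cZ: "compact Z"
    unfolding Z_def by (intro compact_Int_closed less.prems(2) closed_slice_Ext1)
  \<comment> \<open>At \<open>z\<close> the class of \<open>j\<close> is infinite and leads to the
    answer \<open>i\<close>, and \<open>G\<close> is a neighbourhood of \<open>z\<close> on which
    this answer is valid.\<close>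
  define P where "P = (\<lambda>z (i, j, G). finite G \<and> j < k \<and> j \<notin> J \<and> (\<forall>w\<in>E. agrees G z w \<longrightarrow>
      infinite {x. slice w 1 {x} = j} \<longrightarrow> infinite {x. slice w 0 {x} = i}))"
  have "\<exists>t. P z t" if z: "z \<in> Z" for z
  proof -
    have zE: "z \<in> E" using z less.prems(1) by (auto simp: Z_def)
    then have "slice z 1 \<in> Col 1 k" using sel by (simp add: selector_def)
    then obtain j where j: "j < k" "infinite {x. slice z 1 {x} = j}"
      by (rule Col_1_colour_infinite)
    have "j \<notin> J" using less.prems(9) z j(2) by (auto simp: Z_def)
    obtain i G where "finite G" "\<And>w. w \<in> E \<Longrightarrow> agrees G z w \<Longrightarrow> infinite {x. slice w 1 {x} = j} \<Longrightarrow>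
        infinite {x. slice w 0 {x} = i}"
      by (rule selector_1_commit[OF sel zE j(2)]) blast
    then have "P z (i, j, G)" using j(1) \<open>j \<notin> J\<close> by (simp add: P_def)
    then show ?thesis ..
  qed
  then obtain t where t: "\<And>z. z \<in> Z \<Longrightarrow> P z (t z)"
    using bchoice[of Z P] by blast
  define ci where "ci z = fst (t z)" for z
  define cj where "cj z = fst (snd (t z))" for z
  define G where "G z = snd (snd (t z))" for z
  have G: "finite (G z)" and cj: "cj z < k" "cj z \<notin> J" if "z \<in> Z" for z
    using t[OF that] by (auto simp: P_def G_def cj_def split: prod.splits)
  have commit: "infinite {x. slice w 0 {x} = ci z}"
    if "z \<in> Z" "w \<in> E" "agrees (G z) z w" "infinite {x. slice w 1 {x} = cj z}" for z w
    using t[OF that(1)] that(2-) by (auto simp: P_def G_def cj_def ci_def split: prod.splits)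
  obtain C where C: "C \<subseteq> Z" "finite C" "Z \<subseteq> (\<Union>z\<in>C. {w. agrees (G z) z w})"
    by (rule compactE_image[OF cZ, of Z "\<lambda>z. {w. agrees (G z) z w}"]) (auto intro: G open_agrees)
  \<comment> \<open>Finitely many of these neighbourhoods cover \<open>Z\<close>; the category
    argument selects one whose part of \<open>Z\<close> still projects onto a whole smaller
    cylinder.\<close>
  have "\<exists>z\<in>C. \<exists>m'\<ge>m. \<exists>f'\<in>Ext1 l m f A. f' \<in> Ext1 l m' f' A \<and>
    (\<forall>p\<in>Ext1 l m' f' A. \<exists>w\<in>Z \<inter> {w. agrees (G z) z w}. slice w 0 = p)"
  proof (rule Ext1_cover[OF C(2)])
    show "compact (Z \<inter> {w. agrees (G z) z w})" for z
      by (intro compact_Int_closed cZ closed_agrees)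
    show "\<forall>p\<in>Ext1 l m f A. \<exists>z\<in>C. \<exists>w\<in>Z \<inter> {w. agrees (G z) z w}. slice w 0 = p"
    proof
      fix p assume p: "p \<in> Ext1 l m f A"
      then obtain w where w: "w \<in> E'" "slice w 0 = p" using less.prems(8) by blast
      then have "w \<in> Z" using p by (simp add: Z_def)
      with w C(3) show "\<exists>z\<in>C. \<exists>w\<in>Z \<inter> {w. agrees (G z) z w}. slice w 0 = p" by blast
    qed
  qed (rule less.prems(3))
  then obtain z m' f' where zC: "z \<in> C" and m': "m' \<ge> m" and f': "f' \<in> Ext1 l m f A"
    and proj: "\<And>p. p \<in> Ext1 l m' f' A \<Longrightarrow> \<exists>w\<in>Z \<inter> {w. agrees (G z) z w}. slice w 0 = p"
    by blast
  have zZ: "z \<in> Z" using zC C(1) by blast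
  define A' where "A' = A - {ci z}"
  define J' where "J' = insert (cj z) J"
  have J'k: "J' \<subseteq> {..<k}" using cj[OF zZ] less.prems(6) by (auto simp: J'_def)
  have cardJ': "card J' = Suc (card J)" using cj[OF zZ] finJ by (simp add: J'_def)
  \<comment> \<open>If \<open>J\<close> were already all of \<open>{..<k}\<close>, no color
    \<open>cj z\<close> outside \<open>J\<close> could exist; this bound therefore also settles the
    end of the induction.\<close>
  have cardJ'k: "card J' \<le> k" using card_mono[OF _ J'k] by simp
  have cardA': "card A \<le> Suc (card A')"
    using less.prems(4) by (auto simp: A'_def card_Diff_singleton_if)
  then have card': "card A' + card J' \<ge> Suc k"
    using less.prems(7) cardJ' by linarith
  then have "A' \<noteq> {}" using cardJ'k by auto
  then obtain a where a: "a \<in> A'" by blast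
  have al: "a < l" using a less.prems(5) by (auto simp: A'_def)
  obtain f'' where f'': "f'' \<in> Ext1 l m' f' A'"
    using Ext1_obtain[OF _ a al] f' by (auto simp: Ext1_def)
  have sub1: "Ext1 l m' f'' A' \<subseteq> Ext1 l m' f' A'"
    by (rule Ext1_mono[OF f'']) auto
  have sub2: "Ext1 l m' f' A' \<subseteq> Ext1 l m' f' A"
    by (auto simp: Ext1_def A'_def)
  have sub3: "Ext1 l m' f' A \<subseteq> Ext1 l m f A"
    by (rule Ext1_mono[OF f' m']) simp
  show False
  proof (rule less.hyps[of J' "Z \<inter> {w. agrees (G z) z w}" f'' m' A'])
    show "k - card J' < k - card J" using cardJ' cardJ'k by linarith
    show "Z \<inter> {w. agrees (G z) z w} \<subseteq> E" using less.prems(1) by (auto simp: Z_def)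
    show "compact (Z \<inter> {w. agrees (G z) z w})"
      by (intro compact_Int_closed cZ closed_agrees)
    show "f'' \<in> Ext1 l m' f'' A'" using f'' by (auto simp: Ext1_def)
    show "finite A'" "A' \<subseteq> {..<l}" using less.prems(4,5) by (auto simp: A'_def)
    show "J' \<subseteq> {..<k}" "Suc k \<le> card A' + card J'" by fact+
    show "\<forall>p\<in>Ext1 l m' f'' A'. \<exists>w\<in>Z \<inter> {w. agrees (G z) z w}. slice w 0 = p"
      using proj sub1 sub2 by blast
    show "\<forall>w\<in>Z \<inter> {w. agrees (G z) z w}. slice w 0 \<in> Ext1 l m' f'' A' \<longrightarrow>
        (\<forall>j\<in>J'. finite {x. slice w 1 {x} = j})"
    proof (intro ballI impI)
      fix w j
      assume w: "w \<in> Z \<inter> {w. agrees (G z) z w}" "slice w 0 \<in> Ext1 l m' f'' A'" and j: "j \<in> J'"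
      show "finite {x. slice w 1 {x} = j}"
      proof (cases "j = cj z")
        case True
        \<comment> \<open>The color \<open>ci z\<close> is forbidden from \<open>m'\<close> on, so
          its class in slice 0 is finite; the commitment at \<open>z\<close> then excludes an
          infinite class of \<open>cj z\<close> in slice 1.\<close>
        have "{x. slice w 0 {x} = ci z} \<subseteq> {..<m'}"
        proof
          fix x assume "x \<in> {x. slice w 0 {x} = ci z}"
          moreover have "slice w 0 {x} \<in> A'" if "x \<ge> m'" using w(2) that by (simp add: Ext1_def)
          ultimately show "x \<in> {..<m'}" by (force simp: A'_def not_less)
        qed
        then have "finite {x. slice w 0 {x} = ci z}" using finite_subset by blast
        then show ?thesis
          using commit[OF zZ, of w] w(1) less.prems(1) True by (auto simp: Z_def)
      next
        case False
        with j less.prems(9) w(1) show ?thesis by (auto simp: J'_def Z_def)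
      qed
    qed
  qed
qed

text \<open>The stage argument starts with all \<open>k + 1\<close> colors allowed and none made
  finite, which meets the required count exactly.\<close>

lemma no_selector_1: "\<not> selector 1 (Suc k) k E"
proof
  assume sel: "selector 1 (Suc k) k E"
  have "(\<lambda>s. 0) \<in> Ext1 (Suc k) 0 (\<lambda>s. 0) {..<Suc k}"
    by (simp add: Ext1_def Col_def)
  moreover have "\<forall>p\<in>Ext1 (Suc k) 0 (\<lambda>s. 0) {..<Suc k}. \<exists>z\<in>E. slice z 0 = p"
    using sel by (simp add: Ext1_def selector_def)
  ultimately show False
    using selector_1_stage[OF sel order_refl, of "\<lambda>s. 0" 0 "{..<Suc k}" "{}"] sel
    by (simp add: selector_def)
qed

section \<open>Lowering the size of the colored sets\<close>

text \<open>The second condition locks the limits of the \<open>n\<close>-sets below \<open>L\<close> to the values of \<open>q\<close>.\<close>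

definition ExtS :: "nat \<Rightarrow> nat \<Rightarrow> nat \<Rightarrow> (nat set \<Rightarrow> nat) \<Rightarrow> nat \<Rightarrow> (nat set \<Rightarrow> nat) \<Rightarrow> (nat set \<Rightarrow> nat) set" where
  "ExtS n l m f L q = {p \<in> Col (Suc n) l. (\<forall>s. s \<subseteq> {..<m} \<longrightarrow> p s = f s) \<and>
    (\<forall>s\<in>nsets {..<L} n. \<forall>y\<ge>m. p (insert y s) = q s)}"

lemma closed_slice_ExtS: "closed {z. slice z i \<in> ExtS n l m f L q}"
proof -
  have eq: "ExtS n l m f L q = {c. \<forall>s. c s \<in> {v. v < l \<and> (s \<notin> nsets UNIV (Suc n) \<longrightarrow> v = 0) \<and>
      (s \<subseteq> {..<m} \<longrightarrow> v = f s) \<and> (\<forall>t\<in>nsets {..<L} n. \<forall>y\<ge>m. s = insert y t \<longrightarrow> v = q t)}}"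
    by (auto simp: ExtS_def Col_def)
  show ?thesis unfolding eq by (rule closed_slice_family)
qed

lemma ExtS_self: "f \<in> ExtS n l m g L q \<Longrightarrow> m \<le> m' \<Longrightarrow> f \<in> ExtS n l m' f L q"
  by (auto simp: ExtS_def)

text \<open>Because of \<open>L \<le> m\<close>, the sets \<open>insert y s\<close> with
  \<open>m \<le> y < m'\<close> lie below \<open>m'\<close>, where the coloring is already fixed by
  \<open>f'\<close>.\<close>

lemma ExtS_mono:
  assumes "f' \<in> ExtS n l m f L q" "m \<le> m'" "L \<le> m"
  shows "ExtS n l m' f' L q \<subseteq> ExtS n l m f L q"
proof
  fix p assume p: "p \<in> ExtS n l m' f' L q"
  have "p s = f s" if "s \<subseteq> {..<m}" for s
  proof -
    have "s \<subseteq> {..<m'}" using that assms(2) by auto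
    then show ?thesis using p assms(1) that by (simp add: ExtS_def)
  qed
  moreover have "p (insert y s) = q s" if s: "s \<in> nsets {..<L} n" and "y \<ge> m" for s y
  proof (cases "y < m'")
    case True
    then have "insert y s \<subseteq> {..<m'}" using s assms(2,3) by (auto simp: nsets_def)
    then have "p (insert y s) = f' (insert y s)" using p by (simp add: ExtS_def)
    then show ?thesis using assms(1) that by (simp add: ExtS_def)
  next
    case False
    then show ?thesis using p s by (auto simp: ExtS_def)
  qed
  ultimately show "p \<in> ExtS n l m f L q" using p by (simp add: ExtS_def)
qed

lemma ExtS_grow:
  assumes f: "f \<in> ExtS n l m f L q" and q: "q \<in> Col n l" and Lm: "L \<le> m"
  obtains f' where "f' \<in> ExtS n l (Suc m) f' (Suc L) q"
    "ExtS n l (Suc m) f' (Suc L) q \<subseteq> ExtS n l m f L q"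
proof -
  \<comment> \<open>A set reaching beyond \<open>m\<close> gets the limit color of the set without
    its maximum, so the locks of all \<open>n\<close>-sets below \<open>Suc L\<close> hold.\<close>
  define f' where "f' s = (if s \<subseteq> {..<Suc m} then f s
    else if s \<in> nsets UNIV (Suc n) then q (s - {Max s}) else 0)" for s
  have fCol: "f \<in> Col (Suc n) l" using f by (simp add: ExtS_def)
  have l: "0 < l" using ColD(1)[OF q] by (metis gr0I not_less_zero)
  have "f' \<in> Col (Suc n) l"
    using l ColD[OF q] ColD[OF fCol] by (auto simp: Col_def f'_def)
  moreover have "f' (insert y s) = q s" if s: "s \<in> nsets {..<Suc L} n" and y: "y \<ge> Suc m" for s y
  proof -
    have lt: "\<forall>x\<in>s. x < y" using s y Lm by (auto simp: nsets_def)
    have fin: "finite s" using s by (simp add: nsets_def)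
    then have "Max (insert y s) = y"
      using lt by (intro Max_eqI) (auto simp: less_imp_le)
    moreover have "insert y s - {y} = s" using lt by auto
    moreover have "insert y s \<in> nsets UNIV (Suc n)"
      using s lt fin by (auto simp: nsets_def card_insert_if)
    moreover have "\<not> insert y s \<subseteq> {..<Suc m}" using y by auto
    ultimately show ?thesis unfolding f'_def by (simp only: if_False if_True)
  qed
  ultimately have 1: "f' \<in> ExtS n l (Suc m) f' (Suc L) q"
    by (simp add: ExtS_def)
  have "p \<in> ExtS n l m f L q" if p: "p \<in> ExtS n l (Suc m) f' (Suc L) q" for p
  proof -
    have pf: "p s = f s" if "s \<subseteq> {..<Suc m}" for s
      using p that by (simp add: ExtS_def f'_def)
    have "p s = f s" if "s \<subseteq> {..<m}" for s
      using that by (intro pf) auto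
    moreover have "p (insert y s) = q s" if s: "s \<in> nsets {..<L} n" and "y \<ge> m" for s y
    proof (cases "y = m")
      case True
      then have "insert y s \<subseteq> {..<Suc m}" using s Lm by (auto simp: nsets_def)
      then have "p (insert y s) = f (insert y s)" by (rule pf)
      then show ?thesis using f that by (simp add: ExtS_def)
    next
      case False
      have "s \<in> nsets {..<Suc L} n" using s by (auto simp: nsets_def)
      moreover have "Suc m \<le> y" using False that by simp
      ultimately show ?thesis using p by (simp add: ExtS_def)
    qed
    ultimately show ?thesis using p by (simp add: ExtS_def)
  qed
  with 1 show ?thesis using that by blast
qed

section \<open>Deciding reservoirs by compactness\<close>

definition reservoir :: "(nat set \<times> nat) set \<Rightarrow> (nat set \<Rightarrow> nat) \<Rightarrow> nat set" where
  "reservoir Q d = {y. \<forall>(s, j)\<in>Q. d (insert y s) = j}"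

lemma reservoir_slice_eq: "{z. y \<in> reservoir Q (slice z i)} = (\<Inter>(s, j)\<in>Q. {z. z (i, insert y s) \<in> {j}})"
  by (auto simp: reservoir_def slice_def)

lemma open_reservoir: "finite Q \<Longrightarrow> open {z. y \<in> reservoir Q (slice z i)}"
  unfolding reservoir_slice_eq by (intro open_INT) (auto intro: open_coordinate[of _ "{_}", simplified])

lemma closed_reservoir_le:
  assumes "finite Q"
  shows "closed {z. reservoir Q (slice z i) \<subseteq> {..b}}"
proof -
  have eq: "{z. reservoir Q (slice z i) \<subseteq> {..b}} = (\<Inter>y\<in>{b<..}. - {z. y \<in> reservoir Q (slice z i)})"
    by (auto simp: subset_iff not_less[symmetric])
  show ?thesis
    unfolding eq by (intro closed_INT ballI closed_Compl open_reservoir assms)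
qed

text \<open>The second alternative bounds the search above \<open>b\<close> uniformly over
  \<open>E\<close>; this later bounds the terms of prehomogeneous sequences.\<close>

definition decides :: "(nat set \<times> nat) set \<Rightarrow> nat \<Rightarrow> config set \<Rightarrow> bool" where
  "decides Q b E \<longleftrightarrow> (\<forall>z\<in>E. reservoir Q (slice z 1) \<subseteq> {..b}) \<or>
    (\<exists>b'. \<forall>z\<in>E. \<exists>y\<in>reservoir Q (slice z 1). b < y \<and> y \<le> b')"

text \<open>Membership of a fixed \<open>y\<close> in the reservoir is an open condition on
  \<open>z\<close>. A finite subcover uses finitely many \<open>y\<close>, and their maximum bounds
  the search.\<close>

lemma decidesI:
  assumes "compact E" "finite Q" "\<forall>z\<in>E. \<not> reservoir Q (slice z 1) \<subseteq> {..b}"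
  shows "decides Q b E"
proof -
  have "E \<subseteq> (\<Union>y\<in>{b<..}. {z. y \<in> reservoir Q (slice z 1)})"
    using assms(3) by (auto simp: subset_iff not_le)
  with assms(1) open_reservoir[OF assms(2)]
  obtain C where C: "C \<subseteq> {b<..}" "finite C" "E \<subseteq> (\<Union>y\<in>C. {z. y \<in> reservoir Q (slice z 1)})"
    by (rule compactE_image)
  have "\<exists>y\<in>reservoir Q (slice z 1). b < y \<and> y \<le> Max C" if "z \<in> E" for z
  proof -
    from that C(3) obtain y where "y \<in> C" "y \<in> reservoir Q (slice z 1)" by blast
    moreover have "b < y" "y \<le> Max C" using \<open>y \<in> C\<close> C(1,2) by auto
    ultimately show ?thesis by blast
  qed
  then show ?thesis unfolding decides_def by blast
qed

text \<open>Slice 0 must fill a whole cylinder, which leaves room for the finite extensions of later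
  stages.\<close>

definition stage :: "nat \<Rightarrow> nat \<Rightarrow> nat \<Rightarrow> (nat set \<Rightarrow> nat) \<Rightarrow> config set \<Rightarrow> bool" where
  "stage n l L q E \<longleftrightarrow> compact E \<and> (\<exists>m f. L \<le> m \<and> f \<in> ExtS n l m f L q \<and>
    (\<forall>z\<in>E. slice z 0 \<in> ExtS n l m f L q) \<and> (\<forall>p\<in>ExtS n l m f L q. \<exists>z\<in>E. slice z 0 = p))"

lemma stage_refine:
  assumes "compact E" "f \<in> ExtS n l m f L q" "L \<le> m" "q \<in> Col n l"
    "\<forall>p\<in>ExtS n l m f L q. \<exists>z\<in>E. slice z 0 = p"
  shows "\<exists>E'. E' \<subseteq> E \<and> stage n l (Suc L) q E' \<and> (\<forall>z\<in>E'. slice z 0 \<in> ExtS n l m f L q)"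
proof -
  obtain f' where f': "f' \<in> ExtS n l (Suc m) f' (Suc L) q"
    "ExtS n l (Suc m) f' (Suc L) q \<subseteq> ExtS n l m f L q"
    by (rule ExtS_grow[OF assms(2,4,3)])
  let ?E = "E \<inter> {z. slice z 0 \<in> ExtS n l (Suc m) f' (Suc L) q}"
  have "stage n l (Suc L) q ?E"
    unfolding stage_def
  proof (intro conjI exI[of _ "Suc m"] exI[of _ f'])
    show "compact ?E"
      by (intro compact_Int_closed assms(1) closed_slice_ExtS)
    show "\<forall>p\<in>ExtS n l (Suc m) f' (Suc L) q. \<exists>z\<in>?E. slice z 0 = p"
    proof
      fix p assume p: "p \<in> ExtS n l (Suc m) f' (Suc L) q"
      then obtain z where "z \<in> E" "slice z 0 = p"
        using assms(5) subsetD[OF f'(2) p] by auto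
      with p show "\<exists>z\<in>?E. slice z 0 = p" by auto
    qed
    show "f' \<in> ExtS n l (Suc m) f' (Suc L) q" by (rule f'(1))
  qed (use assms(3) in auto)
  then show ?thesis using f'(2) by (intro exI[of _ ?E]) auto
qed

text \<open>Either some extension of the first slice forces every reservoir above \<open>b\<close>, or the reservoir
  can be kept below \<open>b\<close> densely often, hence by compactness for every first slice.\<close>

lemma stage_step:
  assumes q: "q \<in> Col n l" and st: "stage n l L q E" and Q: "finite Q"
  shows "\<exists>E'. E' \<subseteq> E \<and> stage n l (Suc L) q E' \<and> decides Q b E'"
proof -
  obtain m f where Lm: "L \<le> m" and f: "f \<in> ExtS n l m f L q"
    and E: "compact E" and proj: "\<forall>p\<in>ExtS n l m f L q. \<exists>z\<in>E. slice z 0 = p"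
    using st unfolding stage_def by blast
  define N where "N = E \<inter> {z. reservoir Q (slice z 1) \<subseteq> {..b}}"
  have cN: "compact N"
    unfolding N_def by (intro compact_Int_closed E closed_reservoir_le Q)
  show ?thesis
  proof (cases "\<forall>p\<in>ExtS n l m f L q. \<exists>z\<in>N. slice z 0 = p")
    case True
    from stage_refine[OF cN f Lm q this]
    obtain E' where E': "E' \<subseteq> N" "stage n l (Suc L) q E'" by blast
    then have "decides Q b E'" by (auto simp: decides_def N_def)
    with E' show ?thesis by (auto simp: N_def)
  next
    case False
    then obtain f' where f': "f' \<in> ExtS n l m f L q" "\<forall>z\<in>N. slice z 0 \<noteq> f'" by blast
    then have "f' \<in> Col (Suc n) l" by (simp add: ExtS_def)
    from slice_projection_avoid[OF cN this f'(2), of m]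
    obtain m' where m': "m \<le> m'" "\<And>p z. p \<in> Col (Suc n) l \<Longrightarrow>
        \<forall>s. s \<subseteq> {..<m'} \<longrightarrow> p s = f' s \<Longrightarrow> z \<in> N \<Longrightarrow> slice z 0 \<noteq> p"
      by blast
    have sub: "ExtS n l m' f' L q \<subseteq> ExtS n l m f L q"
      by (rule ExtS_mono[OF f'(1) m'(1) Lm])
    have "\<forall>p\<in>ExtS n l m' f' L q. \<exists>z\<in>E. slice z 0 = p"
      using sub proj by blast
    from stage_refine[OF E ExtS_self[OF f'(1) m'(1)] _ q this] Lm m'(1)
    obtain E' where E': "E' \<subseteq> E" "stage n l (Suc L) q E'" "\<forall>z\<in>E'. slice z 0 \<in> ExtS n l m' f' L q"
      by (meson order_trans)
    have "\<not> reservoir Q (slice z 1) \<subseteq> {..b}" if z: "z \<in> E'" for z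
    proof
      assume "reservoir Q (slice z 1) \<subseteq> {..b}"
      then have "z \<in> N" using z E'(1) by (auto simp: N_def)
      with m'(2)[of "slice z 0" z] E'(3) z show False by (auto simp: ExtS_def)
    qed
    moreover have "compact E'" using E'(2) by (simp add: stage_def)
    ultimately have "decides Q b E'" using decidesI Q by blast
    with E' show ?thesis by blast
  qed
qed

section \<open>The tower of stages for a coloring of \<open>n\<close>-sets\<close>

definition restr :: "nat \<Rightarrow> (nat set \<Rightarrow> nat) \<Rightarrow> nat set \<Rightarrow> nat" where
  "restr t q = (\<lambda>s. if s \<subseteq> {..<t} then q s else 0)"

lemma restr_mono:
  assumes "restr t' q = restr t' q'" "t \<le> t'"
  shows "restr t q = restr t q'"
proof
  fix s
  show "restr t q s = restr t q' s"
  proof (cases "s \<subseteq> {..<t}")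
    case True
    then have "s \<subseteq> {..<t'}" using assms(2) by auto
    then show ?thesis using fun_cong[OF assms(1), of s] by (simp add: restr_def)
  qed (simp add: restr_def)
qed

lemma restr_Col: "q \<in> Col n l \<Longrightarrow> restr t q \<in> Col n l"
  by (auto simp: Col_def restr_def)

lemma ExtS_restr: "L \<le> t \<Longrightarrow> ExtS n l m f L (restr t q) = ExtS n l m f L q"
proof -
  assume "L \<le> t"
  then have "restr t q s = q s" if "s \<in> nsets {..<L} n" for s
    using that by (auto simp: restr_def nsets_def)
  then show ?thesis by (simp add: ExtS_def cong: ball_cong)
qed

lemma stage_restr: "L \<le> t \<Longrightarrow> stage n l L (restr t q) E = stage n l L q E"
  by (simp add: stage_def ExtS_restr)

text \<open>Restricting \<open>q\<close> before the choice makes level \<open>t\<close> of the tower depend on finitely many values of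
  \<open>q\<close> only.\<close>

primrec tower :: "nat \<Rightarrow> nat \<Rightarrow> config set \<Rightarrow> (nat \<Rightarrow> (nat set \<times> nat) set) \<Rightarrow> (nat \<Rightarrow> nat) \<Rightarrow>
    (nat set \<Rightarrow> nat) \<Rightarrow> nat \<Rightarrow> config set" where
  "tower n l E Q b q 0 = E"
| "tower n l E Q b q (Suc t) = (SOME E'. E' \<subseteq> tower n l E Q b q t \<and>
    stage n l (Suc t) (restr (Suc t) q) E' \<and> decides (Q t) (b t) E')"

lemma tower_cong: "restr t q = restr t q' \<Longrightarrow> tower n l E Q b q t = tower n l E Q b q' t"
proof (induction t)
  case (Suc t)
  then show ?case using restr_mono[OF Suc.prems, of t] by simp
qed simp

text \<open>By compactness of \<open>Col n k\<close> the colorings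
  \<open>s \<mapsto> d (insert y s)\<close> have a cluster point \<open>e\<close> as
  \<open>y\<close> grows; infinitely many \<open>y\<close> agree with \<open>e\<close> on any finite
  collection of \<open>n\<close>-sets.\<close>

lemma cluster_colouring:
  assumes d: "d \<in> Col (Suc n) k"
  obtains e where "e \<in> Col n k" "\<And>F. finite F \<Longrightarrow> infinite (reservoir ((\<lambda>s. (s, e s)) ` nsets F n) d)"
proof -
  define c where "c y = (\<lambda>s. if s \<in> nsets UNIV n then d (insert y s) else 0)" for y
  have k: "0 < k" using ColD(1)[OF d] by (metis gr0I not_less_zero)
  have c: "c y \<in> Col n k" for y
    using ColD(1)[OF d] k by (auto simp: Col_def c_def)
  have "filtermap c sequentially \<noteq> bot"
    by (simp add: filtermap_bot_iff)
  moreover have "eventually (\<lambda>x. x \<in> Col n k) (filtermap c sequentially)"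
    by (simp add: eventually_filtermap c)
  ultimately obtain e where e: "e \<in> Col n k" "inf (nhds e) (filtermap c sequentially) \<noteq> bot"
    using compact_Col[of n k] unfolding compact_filter by (elim allE impE bexE) auto
  have "infinite (reservoir ((\<lambda>s. (s, e s)) ` nsets F n) d)" if F: "finite F" for F
  proof
    let ?A = "{c. agrees (nsets F n) e c}"
    assume fin: "finite (reservoir ((\<lambda>s. (s, e s)) ` nsets F n) d)"
    have "finite {y. c y \<in> ?A}"
    proof (rule finite_subset[OF _ fin], rule subsetI)
      fix y assume y: "y \<in> {y. c y \<in> ?A}"
      have "d (insert y s) = e s" if "s \<in> nsets F n" for s
      proof -
        have "s \<in> nsets UNIV n" using that by (auto simp: nsets_def)
        then show ?thesis using y that by (auto simp: agrees_def c_def)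
      qed
      then show "y \<in> reservoir ((\<lambda>s. (s, e s)) ` nsets F n) d"
        by (auto simp: reservoir_def)
    qed
    then have "eventually (\<lambda>y. c y \<notin> ?A) sequentially"
      by (metis (mono_tags, lifting) cofinite_eq_sequentially eventually_cofinite mem_Collect_eq
          Collect_cong)
    then have "eventually (\<lambda>x. x \<notin> ?A) (filtermap c sequentially)"
      by (simp add: eventually_filtermap)
    moreover have "eventually (\<lambda>x. x \<in> ?A) (nhds e)"
      by (intro eventually_nhds_in_open open_agrees) (auto simp: F finite_imp_finite_nsets)
    ultimately have "eventually (\<lambda>x. False) (inf (nhds e) (filtermap c sequentially))"
      unfolding eventually_inf by blast
    with e(2) show False by (simp add: trivial_limit_def)
  qed
  with e(1) show ?thesis using that by blast
qed

text \<open>Each step of the tower serves one finite set of conditions with one lower bound, and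
  there are only countably many such pairs.\<close>

lemma requirement_enumeration:
  obtains Q :: "nat \<Rightarrow> (nat set \<times> nat) set" and b :: "nat \<Rightarrow> nat" where "\<And>t. finite (Q t)"
    "\<And>Q' b'. finite Q' \<Longrightarrow> Q' \<subseteq> {s. finite s} \<times> UNIV \<Longrightarrow> \<exists>t. Q t = Q' \<and> b t = b'"
proof -
  let ?R = "{Q :: (nat set \<times> nat) set. finite Q \<and> Q \<subseteq> {s. finite s} \<times> UNIV} \<times> (UNIV :: nat set)"
  have R: "countable ?R"
    by (intro countable_SIGMA countable_Collect_finite_subset) (auto intro: countable_Collect_finite)
  have ne: "({}, 0) \<in> ?R" by simp
  define r where "r = from_nat_into ?R"
  have r: "r t \<in> ?R" for t
    unfolding r_def by (rule from_nat_into) (use ne in blast)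
  have "\<exists>t. fst (r t) = Q' \<and> snd (r t) = b'"
    if "finite Q'" "Q' \<subseteq> {s. finite s} \<times> UNIV" for Q' b'
  proof -
    have "(Q', b') \<in> ?R" using that by simp
    from from_nat_into_surj[OF R this] obtain t where "r t = (Q', b')"
      unfolding r_def by blast
    then have "fst (r t) = Q' \<and> snd (r t) = b'" by simp
    then show ?thesis ..
  qed
  moreover have "finite (fst (r t))" for t using r[of t] by auto
  ultimately show ?thesis using that[of "\<lambda>t. fst (r t)" "\<lambda>t. snd (r t)"] by blast
qed

section \<open>The tower over a fixed selector and its limit points\<close>

locale jump =
  fixes n l k :: nat and E :: "config set" and Q :: "nat \<Rightarrow> (nat set \<times> nat) set" and b :: "nat \<Rightarrow> nat"
  assumes sel: "selector (Suc n) l k E" and n: "n \<ge> 1"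
    and finite_Q: "\<And>t. finite (Q t)"
    and enum: "\<And>Q' b'. finite Q' \<Longrightarrow> Q' \<subseteq> {s. finite s} \<times> UNIV \<Longrightarrow> \<exists>t. Q t = Q' \<and> b t = b'"
begin

abbreviation T :: "(nat set \<Rightarrow> nat) \<Rightarrow> nat \<Rightarrow> config set" where
  "T q t \<equiv> tower n l E Q b q t"

lemma compact_E: "compact E"
  using sel by (simp add: selector_def)

lemma slice_E: "z \<in> E \<Longrightarrow> slice z 0 \<in> Col (Suc n) l" "z \<in> E \<Longrightarrow> slice z 1 \<in> Col (Suc n) k"
  using sel by (simp_all add: selector_def)

lemma stage_0:
  assumes q: "q \<in> Col n l"
  shows "stage n l 0 q E"
proof -
  have l: "0 < l" using ColD(1)[OF q] by (metis gr0I not_less_zero)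
  have "c {} = 0" if "c \<in> Col (Suc n) l" for c
    by (rule ColD(2)[OF that]) (simp add: nsets_def)
  \<comment> \<open>Nothing is locked at the start. For \<open>n = 0\<close> the empty set would
    already be locked.\<close>
  moreover have "nsets {..<0::nat} n = {}"
    using n by (auto simp: nsets_def)
  ultimately have eq: "ExtS n l 0 (\<lambda>s. 0) 0 q = Col (Suc n) l"
    by (auto simp: ExtS_def)
  have "\<forall>p\<in>Col (Suc n) l. \<exists>z\<in>E. slice z 0 = p"
    using sel unfolding selector_def by (elim conjE)
  moreover have "(\<lambda>s. 0) \<in> Col (Suc n) l" using l by (simp add: Col_def)
  ultimately show ?thesis
    unfolding stage_def using compact_E slice_E
    by (intro conjI exI[of _ 0] exI[of _ "\<lambda>s. 0"]) (simp_all add: eq)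
qed

text \<open>The choice in \<open>tower\<close> succeeds: a stage for \<open>q\<close> at level
  \<open>t\<close> is also one for \<open>restr (Suc t) q\<close>, to which
  \<open>stage_step\<close> applies.\<close>

lemma tower_Suc_some:
  assumes q: "q \<in> Col n l" and st: "stage n l t q (T q t)"
  shows "T q (Suc t) \<subseteq> T q t \<and> stage n l (Suc t) (restr (Suc t) q) (T q (Suc t)) \<and>
    decides (Q t) (b t) (T q (Suc t))"
proof -
  have "stage n l t (restr (Suc t) q) (T q t)" using st by (simp add: stage_restr)
  from stage_step[OF restr_Col[OF q] this finite_Q] show ?thesis
    unfolding tower.simps by (rule someI_ex)
qed

lemma tower_stage: "q \<in> Col n l \<Longrightarrow> stage n l t q (T q t)"
proof (induction t)
  case 0
  then show ?case using stage_0 by simp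
next
  case (Suc t)
  then show ?case using tower_Suc_some[of q t] by (simp add: stage_restr del: tower.simps)
qed

lemma tower_decides: "q \<in> Col n l \<Longrightarrow> decides (Q t) (b t) (T q (Suc t))"
  using tower_Suc_some tower_stage by blast

lemma tower_antimono:
  assumes "q \<in> Col n l" "t \<le> t'"
  shows "T q t' \<subseteq> T q t"
  using assms(2)
proof (induction rule: dec_induct)
  case (step t')
  then show ?case using tower_Suc_some[OF assms(1) tower_stage[OF assms(1)], of t'] by blast
qed simp

lemma compact_tower: "q \<in> Col n l \<Longrightarrow> compact (T q t)"
  using tower_stage by (auto simp: stage_def)

lemma tower_nonempty: "q \<in> Col n l \<Longrightarrow> T q t \<noteq> {}"
  using tower_stage[of q t] by (auto simp: stage_def)

text \<open>The levels are nonempty, compact and decreasing.\<close>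

lemma tower_limit:
  assumes q: "q \<in> Col n l"
  obtains z where "\<And>t. z \<in> T q t"
proof -
  have "E \<inter> \<Inter> (T q ` UNIV) \<noteq> {}"
  proof (rule compact_imp_fip_image[OF compact_E])
    show "closed (T q t)" for t
      by (rule compact_fun_nat_imp_closed[OF compact_tower[OF q]])
    fix I :: "nat set" assume "finite I"
    then have "T q (Max (insert 0 I)) \<subseteq> T q t" if "t \<in> insert 0 I" for t
      using that by (intro tower_antimono q Max_ge) auto
    then have "T q (Max (insert 0 I)) \<subseteq> E \<inter> \<Inter> (T q ` I)" by fastforce
    then show "E \<inter> \<Inter> (T q ` I) \<noteq> {}" using tower_nonempty[OF q] by blast
  qed
  then show ?thesis using that by blast
qed

lemma tower_subset_E: "q \<in> Col n l \<Longrightarrow> z \<in> T q t \<Longrightarrow> z \<in> E"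
  using tower_antimono[of q 0 t] by auto

text \<open>Every \<open>n\<close>-set \<open>s\<close> in \<open>S\<close> is locked at some level.
  The infinite set \<open>S\<close> has an element \<open>y\<close> beyond the lock, and the color
  of \<open>insert y s\<close> is then both \<open>i\<close> and \<open>q s\<close>.\<close>

lemma has_homogeneous_limit:
  assumes q: "q \<in> Col n l" and z: "\<And>t. z \<in> T q t" and h: "has_homogeneous (Suc n) i (slice z 0)"
  shows "has_homogeneous n i q"
proof -
  obtain S where S: "infinite S" "\<And>s. s \<in> nsets S (Suc n) \<Longrightarrow> slice z 0 s = i"
    using h by (auto simp: has_homogeneous_def)
  have "q s = i" if s: "s \<in> nsets S n" for s
  proof -
    have fin: "finite s" using s by (simp add: nsets_def)
    then obtain L where L: "s \<subseteq> {..<L}" using finite_nat_bounded by blast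
    obtain m f where "L \<le> m" "slice z 0 \<in> ExtS n l m f L q"
      using tower_stage[OF q, of L] z[of L] unfolding stage_def by blast
    obtain y where y: "y \<in> S" "y \<ge> m"
      using S(1) infinite_nat_iff_unbounded_le by blast
    have "y \<notin> s" using L y(2) \<open>L \<le> m\<close> by auto
    then have "insert y s \<in> nsets S (Suc n)" using s y(1) fin by (auto simp: nsets_def)
    then have "slice z 0 (insert y s) = i" by (rule S(2))
    moreover have "s \<in> nsets {..<L} n" using s L by (auto simp: nsets_def)
    ultimately show ?thesis
      using \<open>slice z 0 \<in> ExtS n l m f L q\<close> y(2) by (simp add: ExtS_def)
  qed
  then show ?thesis using S(1) by (auto simp: has_homogeneous_def)
qed

section \<open>Bounds on the search for the next element\<close>

definition idx :: "(nat set \<times> nat) set \<Rightarrow> nat \<Rightarrow> nat" where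
  "idx Q' b' = (LEAST t. Q t = Q' \<and> b t = b')"

text \<open>It is read off the level right after the requirement is treated, hence from finitely
  many values of \<open>q\<close>. The value is meaningful when the second alternative of
  \<open>decides\<close> holds there.\<close>

definition bound :: "(nat set \<Rightarrow> nat) \<Rightarrow> (nat set \<times> nat) set \<Rightarrow> nat \<Rightarrow> nat" where
  "bound q Q' b' = (LEAST c. \<forall>z\<in>T q (Suc (idx Q' b')).
    \<exists>y\<in>reservoir Q' (slice z 1). b' < y \<and> y \<le> c)"

lemma bound_cong:
  assumes "restr (Suc (idx Q' b')) q = restr (Suc (idx Q' b')) q'"
  shows "bound q Q' b' = bound q' Q' b'"
  unfolding bound_def tower_cong[OF assms] ..

text \<open>An infinite reservoir at a point of the tower rules out the first alternative of
  \<open>decides\<close> at the level where the requirement is treated.\<close>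

lemma bound_spec:
  assumes q: "q \<in> Col n l" and z: "\<And>t. z \<in> T q t" and Q': "finite Q'" "Q' \<subseteq> {s. finite s} \<times> UNIV"
    and inf: "infinite (reservoir Q' (slice z 1))"
  shows "\<exists>y\<in>reservoir Q' (slice z 1). b' < y \<and> y \<le> bound q Q' b'"
proof -
  let ?t = "idx Q' b'"
  have t: "Q ?t = Q' \<and> b ?t = b'"
    unfolding idx_def by (rule LeastI_ex[OF enum[OF Q']])
  have "\<not> reservoir Q' (slice z 1) \<subseteq> {..b'}"
    using inf finite_subset by blast
  then have "\<exists>c. \<forall>z\<in>T q (Suc ?t). \<exists>y\<in>reservoir Q' (slice z 1). b' < y \<and> y \<le> c"
    using tower_decides[OF q, of ?t] z[of "Suc ?t"] t unfolding decides_def by metis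
  then have "\<forall>z\<in>T q (Suc ?t). \<exists>y\<in>reservoir Q' (slice z 1). b' < y \<and> y \<le> bound q Q' b'"
    unfolding bound_def by (rule LeastI_ex)
  then show ?thesis using z[of "Suc ?t"] by blast
qed

text \<open>The bound sees \<open>q\<close> only through a restriction to finitely many sets, and
  there are finitely many such restrictions.\<close>

lemma finite_bound: "finite ((\<lambda>q. bound q Q' b') ` Col n l)"
proof -
  let ?t = "Suc (idx Q' b')"
  let ?F = "{f. \<forall>x. (x \<in> Pow {..<?t} \<longrightarrow> f x \<in> {..<l}) \<and> (x \<notin> Pow {..<?t} \<longrightarrow> f x = (0::nat))}"
  have "finite ?F"
    by (rule finite_set_of_finite_funs) auto
  moreover have "restr ?t ` Col n l \<subseteq> ?F"
    by (auto simp: restr_def dest: ColD(1) split: if_splits)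
  ultimately have "finite (restr ?t ` Col n l)"
    by (rule rev_finite_subset)
  moreover have "bound q Q' b' = bound (restr ?t q) Q' b'" for q
    by (rule bound_cong) (simp add: restr_def fun_eq_iff)
  then have "(\<lambda>q. bound q Q' b') ` Col n l = (\<lambda>q. bound q Q' b') ` restr ?t ` Col n l"
    by (simp add: image_image)
  ultimately show ?thesis by simp
qed

section \<open>Configurations for \<open>n\<close> built from those for \<open>n + 1\<close>\<close>

definition graph :: "nat set \<Rightarrow> (nat set \<Rightarrow> nat) \<Rightarrow> (nat set \<times> nat) set" where
  "graph F e = (\<lambda>s. (s, e s)) ` nsets F n"

text \<open>The inserted 0 gives the empty set a value.\<close>

definition peak :: "nat set \<Rightarrow> nat" where
  "peak F = Max (insert 0 F)"

definition tail :: "config \<Rightarrow> config" where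
  "tail w = (\<lambda>(i, s). w (i + 4, s))"

text \<open>The sequence is stored in slice 2 at the singletons; \<open>E'\<close> fills the rest of
  that slice with 0.\<close>

definition X :: "config \<Rightarrow> nat \<Rightarrow> nat" where
  "X w i = w (2, {i})"

text \<open>The bound, which depends continuously on slice 0, is what keeps the set of prehomogeneous
  sequences compact.\<close>

definition path :: "config \<Rightarrow> nat \<Rightarrow> bool" where
  "path w i \<longleftrightarrow>
    X w i \<in> reservoir (graph (X w ` {..<i}) (slice w 3)) (slice (tail w) 1) \<and>
    peak (X w ` {..<i}) < X w i \<and>
    X w i \<le> bound (slice w 0) (graph (X w ` {..<i}) (slice w 3)) (peak (X w ` {..<i}))"

text \<open>Slices: 0 is the coloring of \<open>n\<close>-sets to be solved, 3 a cluster point of the colorings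
  \<open>s \<mapsto> d (insert y s)\<close>, 2 an increasing sequence prehomogeneous for \<open>d\<close>, 1 the coloring that
  \<open>d\<close> induces on the indices of this sequence, and from 4 on the configuration for \<open>Suc n\<close>, whose
  slice 1 is \<open>d\<close>.\<close>

definition E' :: "config set" where
  "E' = {w. slice w 0 \<in> Col n l \<and> slice w 1 \<in> Col n k \<and> slice w 3 \<in> Col n k \<and>
    (\<forall>s\<in>nsets UNIV n. w (1, s) = w (3, X w ` s)) \<and>
    (\<forall>s. (\<nexists>i. s = {i}) \<longrightarrow> w (2, s) = 0) \<and>
    (\<forall>t. tail w \<in> T (slice w 0) t) \<and>
    (\<forall>i. path w i)}"

lemma slice_tail: "slice (tail w) i = slice w (i + 4)"
  by (simp add: slice_def tail_def)

lemma graph_admissible: "finite F \<Longrightarrow> finite (graph F e)" "finite F \<Longrightarrow> graph F e \<subseteq> {s. finite s} \<times> UNIV"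
  by (auto simp: graph_def finite_imp_finite_nsets nsets_def)

lemma peak_ge: "finite F \<Longrightarrow> x \<in> F \<Longrightarrow> x \<le> peak F"
  by (simp add: peak_def)

lemma X_strict_mono:
  assumes "w \<in> E'"
  shows "strict_mono (X w)"
proof (rule strict_monoI)
  fix i j :: nat assume "i < j"
  then have "X w i \<le> peak (X w ` {..<j})" by (intro peak_ge) auto
  also have "\<dots> < X w j" using assms by (simp add: E'_def path_def)
  finally show "X w i < X w j" .
qed

section \<open>Compactness of \<open>E'\<close>\<close>

lemma closed_determined:
  assumes "\<And>w. \<exists>G. finite G \<and> (\<forall>v. agrees G w v \<longrightarrow> (P v \<longleftrightarrow> P w))"
  shows "closed {w. P w}"
  by (rule closed_fun_natI) (use assms in fastforce)

text \<open>Once the terms up to \<open>i\<close> are fixed, only finitely many values of the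
  cluster coloring, of \<open>d\<close> and of slice 0 enter the condition.\<close>

lemma closed_path: "closed {w. path w i}"
proof (rule closed_determined)
  fix w
  let ?F = "X w ` {..<i}"
  let ?Q = "graph ?F (slice w 3)"
  let ?t = "Suc (idx ?Q (peak ?F))"
  \<comment> \<open>Slice 5 is slice 1 of the tail, that is, the coloring \<open>d\<close>.\<close>
  let ?G = "(\<lambda>j. (2, {j})) ` {..i} \<union> Pair 3 ` nsets ?F n \<union> Pair 0 ` Pow {..<?t} \<union>
    (\<lambda>s. (5, insert (X w i) s)) ` nsets ?F n :: (nat \<times> nat set) set"
  have eqv: "path v i \<longleftrightarrow> path w i" if v: "agrees ?G w v" for v
  proof -
    have X: "X v j = X w j" if "j \<le> i" for j
      unfolding X_def using that by (intro agreesD[OF v]) auto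
    then have F: "X v ` {..<i} = ?F" by (intro image_cong) auto
    have "slice v 3 s = slice w 3 s" if "s \<in> nsets ?F n" for s
      unfolding slice_def using that by (intro agreesD[OF v]) auto
    then have Q: "graph ?F (slice v 3) = ?Q"
      unfolding graph_def by (intro image_cong) auto
    have "slice v 0 s = slice w 0 s" if "s \<subseteq> {..<?t}" for s
      unfolding slice_def using that by (intro agreesD[OF v]) auto
    then have B: "bound (slice v 0) ?Q (peak ?F) = bound (slice w 0) ?Q (peak ?F)"
      by (intro bound_cong) (auto simp: restr_def)
    have "slice (tail v) 1 (insert (X w i) s) = slice (tail w) 1 (insert (X w i) s)"
      if "s \<in> nsets ?F n" for s
      unfolding slice_tail using that by (simp add: slice_def) (intro agreesD[OF v], auto)
    then have R: "X w i \<in> reservoir ?Q (slice (tail v) 1) \<longleftrightarrow> X w i \<in> reservoir ?Q (slice (tail w) 1)"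
      by (auto simp: reservoir_def graph_def)
    show ?thesis
      unfolding path_def F Q X[OF order_refl] B R ..
  qed
  have fin: "finite ?G" by (auto simp: finite_imp_finite_nsets)
  show "\<exists>G. finite G \<and> (\<forall>v. agrees G w v \<longrightarrow> (path v i \<longleftrightarrow> path w i))"
    by (intro exI[of _ ?G] conjI allI impI fin eqv)
qed

lemma closed_colour: "closed {w. s \<in> nsets UNIV n \<longrightarrow> w (1, s) = w (3, X w ` s)}"
proof (rule closed_determined)
  fix w
  show "\<exists>G. finite G \<and> (\<forall>v. agrees G w v \<longrightarrow>
    (s \<in> nsets UNIV n \<longrightarrow> v (1, s) = v (3, X v ` s)) = (s \<in> nsets UNIV n \<longrightarrow> w (1, s) = w (3, X w ` s)))"
  proof (cases "finite s")
    case True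
    let ?G = "{(1, s), (3, X w ` s)} \<union> (\<lambda>i. (2, {i})) ` s :: (nat \<times> nat set) set"
    have eqv: "v (1, s) = v (3, X v ` s) \<longleftrightarrow> w (1, s) = w (3, X w ` s)" if v: "agrees ?G w v" for v
    proof -
      have "X v j = X w j" if "j \<in> s" for j
        unfolding X_def using that by (intro agreesD[OF v]) auto
      then have "X v ` s = X w ` s" by (intro image_cong) auto
      then show ?thesis using v by (simp add: agrees_def)
    qed
    have fin: "finite ?G" using True by simp
    show ?thesis
      by (intro exI[of _ ?G] conjI allI impI fin) (simp only: eqv)
  next
    case False
    then have "s \<notin> nsets UNIV n" by (simp add: nsets_def)
    then show ?thesis by (intro exI[of _ "{}"]) simp
  qed
qed

text \<open>Level \<open>t\<close> of the tower depends on slice 0 only through finitely many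
  values, and each level over a coloring in \<open>Col n l\<close> is closed.\<close>

lemma closed_tower: "closed {w. slice w 0 \<in> Col n l \<and> tail w \<in> T (slice w 0) t}"
proof (rule closed_fun_natI)
  fix w assume w: "w \<notin> {w. slice w 0 \<in> Col n l \<and> tail w \<in> T (slice w 0) t}"
  show "\<exists>G. finite G \<and> (\<forall>v. agrees G w v \<longrightarrow> v \<notin> {w. slice w 0 \<in> Col n l \<and> tail w \<in> T (slice w 0) t})"
  proof (cases "slice w 0 \<in> Col n l")
    case False
    then have "w \<notin> {w. slice w 0 \<in> Col n l}" by simp
    then obtain G where "finite G" "\<And>v. agrees G w v \<Longrightarrow> v \<notin> {w. slice w 0 \<in> Col n l}"
      using closed_fun_natD[OF closed_slice_Col] by blast
    then show ?thesis by (intro exI[of _ G]) auto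
  next
    case True
    then have "tail w \<notin> T (slice w 0) t" using w by simp
    then obtain G where G: "finite G" "\<And>v. agrees G (tail w) v \<Longrightarrow> v \<notin> T (slice w 0) t"
      using closed_fun_natD[OF compact_fun_nat_imp_closed[OF compact_tower[OF True]]] by blast
    let ?G = "(\<lambda>(i, s). (i + 4, s)) ` G \<union> Pair 0 ` Pow {..<t}"
    have eqv: "tail v \<notin> T (slice v 0) t" if v: "agrees ?G w v" for v
    proof -
      have "slice v 0 s = slice w 0 s" if "s \<subseteq> {..<t}" for s
        unfolding slice_def using that by (intro agreesD[OF v]) auto
      then have "restr t (slice v 0) = restr t (slice w 0)" by (auto simp: restr_def)
      then have "T (slice v 0) t = T (slice w 0) t" by (rule tower_cong)
      moreover have "tail v x = tail w x" if "x \<in> G" for x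
        using that by (cases x) (auto simp: tail_def intro!: agreesD[OF v])
      then have "agrees G (tail w) (tail v)" by (simp add: agrees_def)
      ultimately show ?thesis using G(2) by simp
    qed
    have fin: "finite ?G" using G(1) by simp
    show ?thesis
      by (intro exI[of _ ?G] conjI allI impI fin) (use eqv in simp)
  qed
qed

lemma closed_E': "closed E'"
proof -
  have eq: "E' = {w. slice w 1 \<in> Col n k} \<inter> {w. slice w 3 \<in> Col n k} \<inter>
    (\<Inter>s. {w. s \<in> nsets UNIV n \<longrightarrow> w (1, s) = w (3, X w ` s)}) \<inter>
    (\<Inter>s. {w. w (2, s) \<in> {v. (\<nexists>i. s = {i}) \<longrightarrow> v = 0}}) \<inter>
    (\<Inter>t. {w. slice w 0 \<in> Col n l \<and> tail w \<in> T (slice w 0) t}) \<inter> (\<Inter>i. {w. path w i})"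
    by (auto simp: E'_def)
  show ?thesis
    unfolding eq
    by (intro closed_Int closed_INT ballI closed_slice_Col closed_colour closed_coordinate
        closed_tower closed_path)
qed

text \<open>If the terms before \<open>i\<close> are at most \<open>N\<close>, only finitely many
  graphs and peaks can occur, and by \<open>finite_bound\<close> each pair admits finitely many
  bounds for the next term.\<close>

lemma X_bounded: "\<exists>N. \<forall>w\<in>E'. \<forall>j<i. X w j \<le> N"
proof (induction i)
  case 0
  then show ?case by simp
next
  case (Suc i)
  then obtain N where N: "\<And>w j. w \<in> E' \<Longrightarrow> j < i \<Longrightarrow> X w j \<le> N" by blast
  let ?P = "Pow (Pow {..N} \<times> {..<k}) \<times> {..N}"
  let ?V = "\<Union>(Q', b')\<in>?P. (\<lambda>q. bound q Q' b') ` Col n l"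
  have "finite ?V" using finite_bound by auto
  then obtain B where B: "\<forall>v\<in>?V. v \<le> B"
    unfolding finite_nat_set_iff_bounded_le ..
  have "X w j \<le> max N B" if w: "w \<in> E'" and "j < Suc i" for w j
  proof (cases "j = i")
    case True
    let ?F = "X w ` {..<i}"
    have F: "?F \<subseteq> {..N}" using N[OF w] by auto
    then have peak: "peak ?F \<in> {..N}" by (auto simp: peak_def)
    have "slice w 3 \<in> Col n k" using w by (simp add: E'_def)
    then have "graph ?F (slice w 3) \<subseteq> Pow {..N} \<times> {..<k}"
      using subset_trans[OF _ F] by (auto simp: graph_def nsets_def dest: ColD(1))
    with peak have "(graph ?F (slice w 3), peak ?F) \<in> ?P" by simp
    moreover have "slice w 0 \<in> Col n l" using w by (simp add: E'_def)
    then have "bound (slice w 0) (graph ?F (slice w 3)) (peak ?F) \<in>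
        (\<lambda>q. bound q (graph ?F (slice w 3)) (peak ?F)) ` Col n l"
      by (rule imageI)
    ultimately have "bound (slice w 0) (graph ?F (slice w 3)) (peak ?F) \<in> ?V"
      by (intro UN_I[of "(graph ?F (slice w 3), peak ?F)"]) simp_all
    with B have "bound (slice w 0) (graph ?F (slice w 3)) (peak ?F) \<le> B" ..
    moreover have "X w i \<le> bound (slice w 0) (graph ?F (slice w 3)) (peak ?F)"
      using w by (simp add: E'_def path_def)
    ultimately show ?thesis using True by simp
  next
    case False
    then show ?thesis using N[OF w, of j] that by (simp add: max_def)
  qed
  then show ?case by blast
qed

lemma compact_E': "compact E'"
proof (rule compact_fun_natI[OF closed_E'])
  fix x :: "nat \<times> nat set"
  obtain i s where x: "x = (i, s)" by (cases x)
  have Col: "\<exists>b. \<forall>w\<in>E'. w (i, s) \<le> b" if "\<And>w. w \<in> E' \<Longrightarrow> slice w i \<in> Col n c" for i c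
  proof (intro exI[of _ c] ballI)
    fix w assume "w \<in> E'"
    from ColD(1)[OF that[OF this], of s] show "w (i, s) \<le> c" by (simp add: slice_def)
  qed
  consider "i = 0" | "i = 1" | "i = 2" | "i = 3" | j where "i = j + 4"
  proof -
    have "i = 0 \<or> i = 1 \<or> i = 2 \<or> i = 3 \<or> i = (i - 4) + 4" by linarith
    then show thesis using that by blast
  qed
  then show "\<exists>b. \<forall>w\<in>E'. w x \<le> b"
  proof cases
    case 3
    show ?thesis
    proof (cases "\<exists>j. s = {j}")
      case True
      then obtain j where s: "s = {j}" by blast
      obtain N where "\<forall>w\<in>E'. \<forall>j'<Suc j. X w j' \<le> N" using X_bounded by blast
      then show ?thesis using 3 by (auto simp: x s X_def)
    next
      case False
      then show ?thesis using 3 by (auto simp: x E'_def)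
    qed
  next
    case (5 j)
    obtain c where "\<And>z. z \<in> E \<Longrightarrow> z (j, s) \<le> c"
      using compact_coordinate_bounded[OF compact_E] by blast
    moreover have "tail w \<in> E" if "w \<in> E'" for w
      using that tower_subset_E unfolding E'_def by blast
    ultimately have "\<forall>w\<in>E'. tail w (j, s) \<le> c" by blast
    then show ?thesis by (auto simp: x 5 tail_def)
  next
    case 1
    show ?thesis unfolding x 1 by (rule Col[of _ l]) (simp add: E'_def)
  next
    case 2
    show ?thesis unfolding x 2 by (rule Col[of _ k]) (simp add: E'_def)
  next
    case 4
    show ?thesis unfolding x 4 by (rule Col[of _ k]) (simp add: E'_def)
  qed
qed

text \<open>A common point of the tower supplies \<open>d\<close>, a cluster point of its one-point
  extensions supplies slice 3, and greedy picking supplies the sequence. The reservoirs involved are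
  infinite, so \<open>bound_spec\<close> bounds every pick.\<close>

lemma E'_projection:
  assumes q: "q \<in> Col n l"
  shows "\<exists>w\<in>E'. slice w 0 = q"
proof -
  obtain z where z: "\<And>t. z \<in> T q t" by (rule tower_limit[OF q]) blast
  then have zE: "z \<in> E" using tower_subset_E[OF q] by blast
  obtain e where e: "e \<in> Col n k" "\<And>F. finite F \<Longrightarrow> infinite (reservoir (graph F e) (slice z 1))"
    unfolding graph_def by (rule cluster_colouring[OF slice_E(2)[OF zE]]) blast
  have "\<exists>y. y \<in> reservoir (graph F e) (slice z 1) \<and> peak F < y \<and> y \<le> bound q (graph F e) (peak F)"
    if "finite F" for F
    using bound_spec[OF q z graph_admissible[OF that] e(2)[OF that]] by blast
  then obtain pick where pick: "\<And>F. finite F \<Longrightarrow> pick F \<in> reservoir (graph F e) (slice z 1)"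
    "\<And>F. finite F \<Longrightarrow> peak F < pick F" "\<And>F. finite F \<Longrightarrow> pick F \<le> bound q (graph F e) (peak F)"
    by metis
  \<comment> \<open>\<open>H i\<close> collects the first \<open>i\<close> picks; each pick is
    computed from the set of its predecessors.\<close>
  define H where "H = rec_nat {} (\<lambda>_ F. insert (pick F) F)"
  have H: "H 0 = {}" "H (Suc i) = insert (pick (H i)) (H i)" for i
    by (simp_all add: H_def)
  have H_image: "H i = (\<lambda>j. pick (H j)) ` {..<i}" for i
    by (induction i) (auto simp: H lessThan_Suc)
  have H_fin: "finite (H i)" for i by (induction i) (simp_all add: H)
  have k: "0 < k" using ColD(1)[OF e(1)] by (metis gr0I not_less_zero)
  define w :: config where "w = (\<lambda>(i, s).
    if i = 0 then q s
    else if i = 1 then (if s \<in> nsets UNIV n then e ((\<lambda>j. pick (H j)) ` s) else 0)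
    else if i = 2 then (if \<exists>j. s = {j} then pick (H (the_elem s)) else 0)
    else if i = 3 then e s else z (i - 4, s))"
  have Xw: "X w = (\<lambda>j. pick (H j))" by (auto simp: w_def X_def)
  have sl: "slice w 0 = q" "slice w 3 = e" "tail w = z"
    by (auto simp: slice_def w_def tail_def)
  have "slice w 1 \<in> Col n k"
    using ColD(1)[OF e(1)] k by (auto simp: slice_def w_def Col_def)
  moreover have "path w i" for i
    unfolding path_def sl Xw H_image[symmetric] by (intro conjI pick H_fin)
  moreover have "w (2, s) = 0" if "\<nexists>i. s = {i}" for s using that by (auto simp: w_def)
  moreover have "w (1, s) = w (3, X w ` s)" if "s \<in> nsets UNIV n" for s
    unfolding Xw using that by (simp add: w_def)
  ultimately have "w \<in> E'"
    unfolding E'_def mem_Collect_eq sl using q e(1) z by (intro conjI allI ballI impI)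
  with sl(1) show ?thesis by blast
qed

text \<open>By prehomogeneity the \<open>d\<close>-color of a set of terms is the slice 3 color of
  the set without its largest term, which slice 1 copies to the indices.\<close>

lemma E'_homogeneous:
  assumes w: "w \<in> E'" and M: "infinite M" "homogeneous n (slice w 1) M"
  shows "infinite (X w ` M)" "homogeneous (Suc n) (slice (tail w) 1) (X w ` M)"
proof -
  have mono: "strict_mono (X w)" by (rule X_strict_mono[OF w])
  have inj: "inj_on (X w) A" for A using mono strict_mono_imp_inj_on by blast
  show "infinite (X w ` M)" using M(1) finite_image_iff[OF inj] by blast
  obtain j where j: "\<And>s. s \<in> nsets M n \<Longrightarrow> slice w 1 s = j"
    using M(2) by (auto simp: homogeneous_def)
  have "slice (tail w) 1 s = j" if s: "s \<in> nsets (X w ` M) (Suc n)" for s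
  proof -
    obtain r where r: "r \<in> nsets M (Suc n)" "s = X w ` r"
      by (rule nset_image_obtains[OF s inj])
    define y where "y = Max r"
    have fin: "finite r" and "r \<noteq> {}" using r(1) by (auto simp: nsets_def)
    then have y: "y \<in> r" "\<And>x. x \<in> r \<Longrightarrow> x \<le> y" by (simp_all add: y_def)
    define t where "t = r - {y}"
    have t: "t \<in> nsets M n" using r(1) y(1) by (auto simp: t_def nsets_def)
    have ty: "t \<subseteq> {..<y}" using y(2) by (fastforce simp: t_def)
    have "X w ` t \<in> nsets (X w ` {..<y}) n"
      using t ty by (auto simp: nsets_def card_image[OF inj])
    moreover have "path w y" using w by (simp add: E'_def)
    ultimately have "slice (tail w) 1 (insert (X w y) (X w ` t)) = slice w 3 (X w ` t)"
      by (auto simp: path_def reservoir_def graph_def)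
    moreover have "insert (X w y) (X w ` t) = s" using y(1) by (auto simp: r(2) t_def)
    moreover have "t \<in> nsets UNIV n" using t by (auto simp: nsets_def)
    then have "slice w 3 (X w ` t) = slice w 1 t" using w by (auto simp: E'_def slice_def)
    ultimately show ?thesis using j[OF t] by simp
  qed
  then show "homogeneous (Suc n) (slice (tail w) 1) (X w ` M)"
    unfolding homogeneous_def by blast
qed

text \<open>A homogeneous set of slice 1 is moved along \<open>X w\<close> to one of
  \<open>d\<close>; the commitment of \<open>E\<close> applies there, and
  \<open>has_homogeneous_limit\<close> brings the color back to slice 0.\<close>

lemma selector_E': "selector n l k E'"
  unfolding selector_def
proof (intro conjI)
  show "\<forall>z\<in>E'. \<forall>M. infinite M \<and> homogeneous n (slice z 1) M \<longrightarrow>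
      (\<exists>i G m. finite G \<and>
        (\<forall>w\<in>E'. \<forall>N. infinite N \<and> homogeneous n (slice w 1) N \<and> agrees G z w \<and> N \<inter> {..m} = M \<inter> {..m}
          \<longrightarrow> has_homogeneous n i (slice w 0)))"
  proof (intro ballI allI impI, elim conjE)
    fix w M assume w: "w \<in> E'" and M: "infinite M" "homogeneous n (slice w 1) M"
    have tail_E: "tail v \<in> E" if "v \<in> E'" for v
      using that tower_subset_E unfolding E'_def by blast
    obtain i G m where G: "finite G" and commit: "\<And>z N. z \<in> E \<Longrightarrow> infinite N \<Longrightarrow>
      homogeneous (Suc n) (slice z 1) N \<Longrightarrow> agrees G (tail w) z \<Longrightarrow>
      N \<inter> {..m} = (X w ` M) \<inter> {..m} \<Longrightarrow> has_homogeneous (Suc n) i (slice z 0)"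
      by (rule selector_commit[OF sel tail_E[OF w] E'_homogeneous[OF w M]]) blast
    let ?G = "(\<lambda>(i, s). (i + 4, s)) ` G \<union> (\<lambda>j. (2, {j})) ` {..m}"
    have hom: "has_homogeneous n i (slice v 0)"
      if v: "v \<in> E'" "agrees ?G w v" and N: "infinite N" "homogeneous n (slice v 1) N"
        "N \<inter> {..m} = M \<inter> {..m}" for v N
    proof -
      have "tail v x = tail w x" if "x \<in> G" for x
        using that by (cases x) (auto simp: tail_def intro!: agreesD[OF v(2)])
      then have ag: "agrees G (tail w) (tail v)" by (simp add: agrees_def)
      have X: "X v j = X w j" if "j \<le> m" for j
        unfolding X_def using that by (intro agreesD[OF v(2)]) auto
      \<comment> \<open>Since \<open>X u j \<ge> j\<close>, terms up to \<open>m\<close> come from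
        indices up to \<open>m\<close>; these terms are fixed by the second part of
        \<open>?G\<close>.\<close>
      have initial: "(X u ` A) \<inter> {..m} = {x \<in> X u ` (A \<inter> {..m}). x \<le> m}" if "u \<in> E'" for u A
        using strict_mono_imp_increasing[OF X_strict_mono[OF that]] by (auto intro: order_trans)
      have "X v ` (N \<inter> {..m}) = X w ` (M \<inter> {..m})"
        unfolding N(3) using X by (intro image_cong) auto
      then have "(X v ` N) \<inter> {..m} = (X w ` M) \<inter> {..m}"
        unfolding initial[OF v(1)] initial[OF w] by simp
      from commit[OF tail_E[OF v(1)] E'_homogeneous[OF v(1) N(1,2)] ag this]
      have "has_homogeneous (Suc n) i (slice (tail v) 0)" .
      moreover have "slice v 0 \<in> Col n l" "\<And>t. tail v \<in> T (slice v 0) t"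
        using v(1) by (simp_all add: E'_def)
      ultimately show ?thesis using has_homogeneous_limit by blast
    qed
    have fin: "finite ?G" using G by simp
    show "\<exists>i G m. finite G \<and>
        (\<forall>v\<in>E'. \<forall>N. infinite N \<and> homogeneous n (slice v 1) N \<and> agrees G w v \<and> N \<inter> {..m} = M \<inter> {..m}
          \<longrightarrow> has_homogeneous n i (slice v 0))"
      by (rule exI[of _ i], rule exI[of _ ?G], rule exI[of _ m], intro conjI ballI allI impI fin)
        (elim conjE, rule hom)
  qed
qed (use compact_E' E'_projection in \<open>auto simp: E'_def\<close>)

end

lemma selector_jump:
  assumes "selector (Suc n) l k E" "n \<ge> 1"
  obtains E' where "selector n l k E'"
proof -
  obtain Q :: "nat \<Rightarrow> (nat set \<times> nat) set" and b :: "nat \<Rightarrow> nat" where "\<And>t. finite (Q t)"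
    "\<And>Q' b'. finite Q' \<Longrightarrow> Q' \<subseteq> {s. finite s} \<times> UNIV \<Longrightarrow> \<exists>t. Q t = Q' \<and> b t = b'"
    by (rule requirement_enumeration) blast
  with assms interpret jump n l k E Q b by unfold_locales
  show ?thesis by (rule that[OF selector_E'])
qed

lemma no_selector: "n \<ge> 1 \<Longrightarrow> \<not> selector n (Suc k) k E"
proof (induction n arbitrary: E rule: nat_induct_at_least)
  case base
  show ?case by (rule no_selector_1)
next
  case (Suc n)
  then show ?case by (meson selector_jump)
qed

section \<open>Weihrauch reductions\<close>

text \<open>The use principle: a halting computation asks the oracle only finitely many
  questions.\<close>

lemma computes_use:
  "computes p e xs y \<Longrightarrow> \<exists>m. \<forall>p'. (\<forall>x<m. p' x = p x) \<longrightarrow> computes p' e xs y"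
proof (induction rule: computes.induct)
  case (Query x)
  show ?case
    by (intro exI[of _ "Suc x"]) (metis computes.Query lessI)
next
  case (Comp xs gs ys f z)
  have "\<exists>m. \<forall>p'. (\<forall>x<m. p' x = p x) \<longrightarrow> list_all2 (\<lambda>g y. computes p' g xs y) gs ys"
    using Comp.IH(1)
  proof (induction rule: list_all2_induct)
    case (Cons g gs y ys)
    then obtain m m' where "\<forall>p'. (\<forall>x<m. p' x = p x) \<longrightarrow> computes p' g xs y"
      "\<forall>p'. (\<forall>x<m'. p' x = p x) \<longrightarrow> list_all2 (\<lambda>g y. computes p' g xs y) gs ys"
      by blast
    then show ?case by (intro exI[of _ "max m m'"]) simp
  qed simp
  with Comp.IH(2) obtain m m' where
    m: "\<forall>p'. (\<forall>x<m. p' x = p x) \<longrightarrow> list_all2 (\<lambda>g y. computes p' g xs y) gs ys"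
    and m': "\<forall>p'. (\<forall>x<m'. p' x = p x) \<longrightarrow> computes p' f ys z"
    by blast
  have "computes p' (Comp f gs) xs z" if p': "\<forall>x<max m m'. p' x = p x" for p'
  proof (rule computes.Comp)
    show "list_all2 (\<lambda>g y. computes p' g xs y) gs ys" using m p' by simp
    show "computes p' f ys z" using m' p' by simp
  qed
  then show ?case by blast
next
  case (PrimRec_0 f xs y g)
  then show ?case by (meson computes.PrimRec_0)
next
  case (PrimRec_Suc f g m xs y z)
  then obtain a b where a: "\<forall>p'. (\<forall>x<a. p' x = p x) \<longrightarrow> computes p' (PrimRec f g) (m # xs) y"
    and b: "\<forall>p'. (\<forall>x<b. p' x = p x) \<longrightarrow> computes p' g (m # y # xs) z"
    by blast
  have "computes p' (PrimRec f g) (Suc m # xs) z" if p': "\<forall>x<max a b. p' x = p x" for p'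
  proof (rule computes.PrimRec_Suc)
    show "computes p' (PrimRec f g) (m # xs) y" using a p' by simp
    show "computes p' g (m # y # xs) z" using b p' by simp
  qed
  then show ?case by blast
next
  case (Minim f m xs)
  from Minim.IH(2) obtain u where
    u: "\<And>i. i < m \<Longrightarrow> \<exists>y>0. \<forall>p'. (\<forall>x<u i. p' x = p x) \<longrightarrow> computes p' f (i # xs) y"
    by metis
  from Minim.IH(1) obtain a where
    a: "\<forall>p'. (\<forall>x<a. p' x = p x) \<longrightarrow> computes p' f (m # xs) 0" by blast
  \<comment> \<open>The sum is a common bound on the uses of all tests before
    \<open>m\<close>.\<close>
  have le: "u i \<le> (\<Sum>i<m. u i)" if "i < m" for i
    using that by (intro member_le_sum) auto
  have "computes p' (Minim f) xs m" if p': "\<forall>x<a + (\<Sum>i<m. u i). p' x = p x" for p'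
  proof (rule computes.Minim)
    show "computes p' f (m # xs) 0" using a p' by simp
    show "\<forall>i<m. \<exists>y>0. computes p' f (i # xs) y"
    proof (intro allI impI)
      fix i assume "i < m"
      then have "\<forall>x<u i. p' x = p x" using p' le[of i] by auto
      with u[OF \<open>i < m\<close>] show "\<exists>y>0. computes p' f (i # xs) y" by blast
    qed
  qed
  then show ?case by blast
qed (auto intro: computes.intros)

lemma computes_use_finite:
  assumes "finite A" "\<And>x. x \<in> A \<Longrightarrow> computes p e [x] (q x)"
  obtains m where "\<And>p' x. \<forall>y<m. p' y = p y \<Longrightarrow> x \<in> A \<Longrightarrow> computes p' e [x] (q x)"
proof -
  obtain u where u: "\<And>x p'. x \<in> A \<Longrightarrow> \<forall>y<u x. p' y = p y \<Longrightarrow> computes p' e [x] (q x)"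
    using computes_use[OF assms(2)] by metis
  have "u x \<le> sum u A" if "x \<in> A" for x
    using that assms(1) by (intro member_le_sum) auto
  then show ?thesis by (intro that[of "sum u A"] u) (meson order_less_le_trans)+
qed

section \<open>Names and realizers of \<open>RT n k\<close>\<close>

definition name :: "nat \<Rightarrow> (nat set \<Rightarrow> nat) \<Rightarrow> baire" where
  "name n c = (\<lambda>i. c (theta n i))"

lemma theta_in_nsets: "n \<ge> 1 \<Longrightarrow> theta n i \<in> nsets UNIV n"
  using bij_betw_theta[of n] by (auto simp: bij_betw_def)

lemma theta_inv:
  assumes "n \<ge> 1" "s \<in> nsets UNIV n"
  obtains i where "s = theta n i" "inv (theta n) s = i"
proof -
  obtain i where "s = theta n i" using bij_betw_theta[OF assms(1)] assms(2) by (auto simp: bij_betw_def)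
  moreover have "inj (theta n)" using bij_betw_theta[OF assms(1)] by (simp add: bij_betw_def)
  ultimately show ?thesis using that by (simp add: inv_f_f)
qed

lemma coloring_rep_name:
  assumes "n \<ge> 1" "c \<in> Col n l"
  shows "coloring_rep n l (name n c) = Some (restrict c (nsets UNIV n))"
  unfolding coloring_rep_eq_Some_iff[OF assms(1)]
  using assms theta_in_nsets[OF assms(1)] by (auto simp: colorings_def name_def dest: ColD(1))

lemma homogeneous_cong:
  assumes "\<And>s. s \<in> nsets UNIV n \<Longrightarrow> c s = d s"
  shows "homogeneous n c M = homogeneous n d M"
proof -
  have "c s = d s" if "s \<in> nsets M n" for s
    using that by (intro assms) (auto simp: nsets_def)
  then show ?thesis by (simp add: homogeneous_def cong: ball_cong)
qed

lemma infinite_homogeneous_exists: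
  assumes "c \<in> colorings n k"
  obtains M where "infinite M" "homogeneous n c M"
proof -
  have "c ` nsets UNIV n \<subseteq> {..<k}" using assms by (auto simp: colorings_def)
  from Ramsey_nsets[OF infinite_UNIV_nat this] obtain M j where "infinite M" "c ` nsets M n \<subseteq> {j}"
    by metis
  then have "\<forall>s\<in>nsets M n. c s = j" by blast
  with \<open>infinite M\<close> show ?thesis by (intro that) (auto simp: homogeneous_def)
qed

lemma cantor_rep_indicator: "cantor_rep (indicator M) = Some (indicator M)"
proof -
  have "range (indicator M :: baire) \<subseteq> {0, 1}" by (auto simp: indicator_def)
  then show ?thesis by (simp add: cantor_rep_def)
qed

text \<open>Ramsey's theorem gives every coloring a solution, so all colorings lie in the domain;
  the output representation is the identity on 0-1 sequences.\<close>

lemma realizes_RT_iff: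
  assumes "n \<ge> 1"
  shows "realizes G (RT n k) \<longleftrightarrow> (\<forall>p c. coloring_rep n k p = Some c \<longrightarrow>
    (\<exists>M. infinite M \<and> homogeneous n c M \<and> G p = Some (indicator M)))" (is "_ \<longleftrightarrow> ?R")
proof -
  have ne: "sols (RT n k) c \<noteq> {} \<and> c \<in> colorings n k" if "coloring_rep n k p = Some c" for p c
  proof -
    have c: "c \<in> colorings n k" using that coloring_rep_eq_Some_iff[OF assms] by blast
    obtain M where "infinite M" "homogeneous n c M" by (rule infinite_homogeneous_exists[OF c])
    then show ?thesis using c by (auto simp: RT_def)
  qed
  have sol: "(\<exists>q y. G p = Some q \<and> cantor_rep q = Some y \<and> y \<in> sols (RT n k) c) \<longleftrightarrow>
      (\<exists>M. infinite M \<and> homogeneous n c M \<and> G p = Some (indicator M))"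
    if "c \<in> colorings n k" for p c
  proof
    assume "\<exists>q y. G p = Some q \<and> cantor_rep q = Some y \<and> y \<in> sols (RT n k) c"
    then show "\<exists>M. infinite M \<and> homogeneous n c M \<and> G p = Some (indicator M)"
      by (auto simp: RT_def cantor_rep_def split: if_splits)
  next
    assume "\<exists>M. infinite M \<and> homogeneous n c M \<and> G p = Some (indicator M)"
    then show "\<exists>q y. G p = Some q \<and> cantor_rep q = Some y \<and> y \<in> sols (RT n k) c"
      using that cantor_rep_indicator by (auto simp: RT_def)
  qed
  have rep: "in_rep (RT n k) = coloring_rep n k" "out_rep (RT n k) = cantor_rep"
    by (simp_all add: RT_def)
  show ?thesis
    unfolding realizes_def rep
  proof (rule iffI; intro allI impI)
    fix p c
    assume *: "\<forall>p c. coloring_rep n k p = Some c \<and> sols (RT n k) c \<noteq> {} \<longrightarrow>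
        (\<exists>q y. G p = Some q \<and> cantor_rep q = Some y \<and> y \<in> sols (RT n k) c)"
      and p: "coloring_rep n k p = Some c"
    have "\<exists>q y. G p = Some q \<and> cantor_rep q = Some y \<and> y \<in> sols (RT n k) c"
      using *[rule_format, of p c] ne[OF p] p by simp
    then show "\<exists>M. infinite M \<and> homogeneous n c M \<and> G p = Some (indicator M)"
      using sol ne[OF p] by simp
  next
    fix p c
    assume *: ?R and p: "coloring_rep n k p = Some c \<and> sols (RT n k) c \<noteq> {}"
    then show "\<exists>q y. G p = Some q \<and> cantor_rep q = Some y \<and> y \<in> sols (RT n k) c"
      using sol ne[of p c] by simp
  qed
qed

text \<open>A realizer that is undefined off the names of colorings forces a reduction to send names
  of instances to names of instances.\<close>

lemma realizer_exists:
  assumes "n \<ge> 1"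
  obtains G where "realizes G (RT n k)" "\<And>r. coloring_rep n k r = None \<Longrightarrow> G r = None"
proof -
  define G :: "baire \<rightharpoonup> baire" where "G r = map_option
    (\<lambda>c. indicator (SOME M. infinite M \<and> homogeneous n c M)) (coloring_rep n k r)" for r
  have "realizes G (RT n k)"
    unfolding realizes_RT_iff[OF assms]
  proof (intro allI impI)
    fix p c assume p: "coloring_rep n k p = Some c"
    let ?M = "SOME M. infinite M \<and> homogeneous n c M"
    have "c \<in> colorings n k" using p coloring_rep_eq_Some_iff[OF assms] by blast
    then have "\<exists>M. infinite M \<and> homogeneous n c M" by (metis infinite_homogeneous_exists)
    then have "infinite ?M \<and> homogeneous n c ?M" by (rule someI_ex)
    then show "\<exists>M. infinite M \<and> homogeneous n c M \<and> G p = Some (indicator M)"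
      using p by (auto simp: G_def)
  qed
  then show ?thesis using that by (simp add: G_def)
qed

text \<open>The configurations pair a coloring \<open>c\<close> with the instance \<open>D c\<close>
  that \<open>K\<close> assigns to its name, without further advice. Computability of
  \<open>K\<close> makes \<open>D\<close> continuous, so they form a compact set; an answer of
  \<open>H\<close> reveals its color once \<open>n\<close> of its elements are known.\<close>

lemma weihrauch_le_RT_selector:
  assumes n: "n \<ge> 1" and red: "RT n l \<le>\<^sub>W RT n k"
  obtains E where "selector n l k E"
proof -
  obtain H K where "computable H" "computable K" and
    HK: "\<And>G. realizes G (RT n k) \<Longrightarrow>
        realizes (\<lambda>p. Option.bind (K p) (\<lambda>r. Option.bind (G r) (\<lambda>s. H (pair p s)))) (RT n l)"
    using red unfolding weihrauch_le_def by blast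
  then obtain h a where h: "\<And>p q i. H p = Some q \<Longrightarrow> computes p h [i] (q i)"
    and a: "\<And>p q i. K p = Some q \<Longrightarrow> computes p a [i] (q i)"
    unfolding computable_def by metis
  have K: "\<exists>r d. K (name n c) = Some r \<and> coloring_rep n k r = Some d" if c: "c \<in> Col n l" for c
  proof -
    obtain G where G: "realizes G (RT n k)" "\<And>r. coloring_rep n k r = None \<Longrightarrow> G r = None"
      using realizer_exists[OF n] by blast
    obtain M where "Option.bind (K (name n c)) (\<lambda>r. Option.bind (G r) (\<lambda>s. H (pair (name n c) s))) =
        Some (indicator M)"
      using HK[OF G(1)] coloring_rep_name[OF n c] unfolding realizes_RT_iff[OF n] by blast
    then obtain r s where "K (name n c) = Some r" "G r = Some s"
      by (auto simp: bind_eq_Some_conv)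
    with G(2)[of r] show ?thesis by (cases "coloring_rep n k r") auto
  qed
  have H: "\<exists>S. infinite S \<and> homogeneous n c S \<and> H (pair (name n c) (indicator M)) = Some (indicator S)"
    if c: "c \<in> Col n l" and r: "K (name n c) = Some r" "coloring_rep n k r = Some d"
      and M: "infinite M" "homogeneous n d M" for c r d M
  proof -
    obtain G where G: "realizes G (RT n k)" using realizer_exists[OF n] by blast
    \<comment> \<open>A realizer may answer the instance \<open>r\<close> by any infinite
      homogeneous set, so \<open>H\<close> must succeed on each of them.\<close>
    have "realizes (G(r \<mapsto> indicator M)) (RT n k)"
      using G r M unfolding realizes_RT_iff[OF n] by auto
    from HK[OF this] coloring_rep_name[OF n c] obtain S where S: "infinite S"
      "homogeneous n (restrict c (nsets UNIV n)) S"
      "Option.bind (K (name n c)) (\<lambda>r'. Option.bind ((G(r \<mapsto> indicator M)) r') (\<lambda>s. H (pair (name n c) s))) =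
        Some (indicator S)"
      unfolding realizes_RT_iff[OF n] by blast
    have "homogeneous n c S"
      using S(2) homogeneous_cong[of n c "restrict c (nsets UNIV n)"] by simp
    with S(1,3) r(1) show ?thesis by auto
  qed
  define D where "D c = (\<lambda>s. if s \<in> nsets UNIV n then the (K (name n c)) (inv (theta n) s) else 0)" for c
  have D: "D c \<in> Col n k \<and> (\<forall>s\<in>nsets UNIV n. D c s = d s)"
    if c: "c \<in> Col n l" and r: "K (name n c) = Some r" "coloring_rep n k r = Some d" for c r d
  proof -
    have d: "d \<in> colorings n k" "\<And>i. r i = d (theta n i)"
      using r(2) coloring_rep_eq_Some_iff[OF n] by blast+
    have eq: "D c s = d s" if s: "s \<in> nsets UNIV n" for s
    proof -
      obtain i where "s = theta n i" "inv (theta n) s = i" by (rule theta_inv[OF n s])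
      then show ?thesis using s r(1) d(2) by (simp add: D_def)
    qed
    have dk: "d s < k" if "s \<in> nsets UNIV n" for s
      using d(1) that by (auto simp: colorings_def)
    have "0 < k" using dk[OF theta_in_nsets[OF n, of 0]] by simp
    have "D c s < k \<and> (s \<notin> nsets UNIV n \<longrightarrow> D c s = 0)" for s
    proof (cases "s \<in> nsets UNIV n")
      case True
      then show ?thesis using eq dk by simp
    next
      case False
      then show ?thesis using \<open>0 < k\<close> by (simp add: D_def)
    qed
    then have "D c \<in> Col n k" by (simp add: Col_def)
    with eq show ?thesis by blast
  qed
  have D_continuous: "\<exists>G. finite G \<and> (\<forall>c'\<in>Col n l. agrees G c c' \<longrightarrow> D c' s = D c s)"
    if c: "c \<in> Col n l" for c s
  proof -
    obtain r where r: "K (name n c) = Some r" using K[OF c] by blast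
    let ?i = "inv (theta n) s"
    from computes_use[OF a[OF r, of ?i]] obtain m where
      m: "\<And>p'. \<forall>x<m. p' x = name n c x \<Longrightarrow> computes p' a [?i] (r ?i)"
      by blast
    have "D c' s = D c s" if c': "c' \<in> Col n l" and ag: "agrees (theta n ` {..<m}) c c'" for c'
    proof -
      obtain r' where r': "K (name n c') = Some r'" using K[OF c'] by blast
      have "computes (name n c') a [?i] (r ?i)"
        using ag by (intro m) (auto simp: name_def agrees_def)
      with a[OF r', of ?i] have "r' ?i = r ?i" by (rule computes_deterministic)
      then show ?thesis using r r' by (simp add: D_def)
    qed
    then show ?thesis by (intro exI[of _ "theta n ` {..<m}"]) auto
  qed
  define E :: "config set" where "E = {z. slice z 0 \<in> Col n l \<and> slice z 1 = D (slice z 0) \<and>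
    (\<forall>i s. i \<ge> 2 \<longrightarrow> z (i, s) = 0)}"
  have closed_E: "closed E"
  proof (rule closed_fun_natI)
    fix z assume z: "z \<notin> E"
    consider "slice z 0 \<notin> Col n l"
      | s where "slice z 0 \<in> Col n l" "slice z 1 s \<noteq> D (slice z 0) s"
      | i s where "i \<ge> 2" "z (i, s) \<noteq> 0"
      using z unfolding E_def by (auto simp: fun_eq_iff)
    then show "\<exists>G. finite G \<and> (\<forall>w. agrees G z w \<longrightarrow> w \<notin> E)"
    proof cases
      case 1
      then have "z \<notin> {z. slice z 0 \<in> Col n l}" by simp
      then obtain G where "finite G" "\<And>w. agrees G z w \<Longrightarrow> w \<notin> {z. slice z 0 \<in> Col n l}"
        using closed_fun_natD[OF closed_slice_Col] by blast
      then show ?thesis by (intro exI[of _ G]) (auto simp: E_def)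
    next
      case (2 s)
      then obtain G where G: "finite G" "\<And>c'. c' \<in> Col n l \<Longrightarrow> agrees G (slice z 0) c' \<Longrightarrow>
          D c' s = D (slice z 0) s"
        using D_continuous[OF 2(1), of s] by blast
      have "w \<notin> E" if w: "agrees (insert (1, s) (Pair 0 ` G)) z w" for w
      proof
        assume "w \<in> E"
        then have "slice w 1 s = D (slice w 0) s" "slice w 0 \<in> Col n l" by (simp_all add: E_def)
        moreover have "agrees G (slice z 0) (slice w 0)" "slice w 1 s = slice z 1 s"
          using w by (auto simp: agrees_def slice_def)
        ultimately show False using G(2)[of "slice w 0"] 2(2) by simp
      qed
      then show ?thesis using G(1) by (intro exI[of _ "insert (1, s) (Pair 0 ` G)"]) auto
    next
      case (3 i s)
      have "w \<notin> E" if "agrees {(i, s)} z w" for w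
      proof
        assume "w \<in> E"
        then have "w (i, s) = 0" using 3(1) by (simp add: E_def)
        then show False using that 3(2) by (simp add: agrees_def)
      qed
      then show ?thesis by (intro exI[of _ "{(i, s)}"]) auto
    qed
  qed
  have E_Col: "slice z 0 \<in> Col n l" "slice z 1 \<in> Col n k" if "z \<in> E" for z
  proof -
    show 0: "slice z 0 \<in> Col n l" using that by (simp add: E_def)
    obtain r d where "K (name n (slice z 0)) = Some r" "coloring_rep n k r = Some d"
      using K[OF 0] by blast
    from D[OF 0 this] show "slice z 1 \<in> Col n k" using that by (simp add: E_def)
  qed
  have "\<exists>b. \<forall>z\<in>E. z x \<le> b" for x
  proof (intro exI ballI)
    fix z assume z: "z \<in> E"
    obtain i s where x: "x = (i, s)" by (cases x)
    consider "i = 0" | "i = 1" | "i \<ge> 2" by linarith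
    then show "z x \<le> l + k"
      using ColD(1)[OF E_Col(1)[OF z], of s] ColD(1)[OF E_Col(2)[OF z], of s] z
      by cases (auto simp: x slice_def E_def)
  qed
  then have compact_E: "compact E" by (intro compact_fun_natI closed_E)
  have proj: "\<exists>z\<in>E. slice z 0 = c" if c: "c \<in> Col n l" for c
  proof -
    let ?z = "\<lambda>(i, s). if i = 0 then c s else if i = 1 then D c s else 0"
    have "slice ?z 0 = c" "slice ?z 1 = D c" by (simp_all add: slice_def)
    then show ?thesis using c by (intro bexI[of _ ?z]) (auto simp: E_def)
  qed
  have commit: "\<exists>i G m. finite G \<and>
        (\<forall>w\<in>E. \<forall>N. infinite N \<and> homogeneous n (slice w 1) N \<and> agrees G z w \<and> N \<inter> {..m} = M \<inter> {..m}
          \<longrightarrow> has_homogeneous n i (slice w 0))"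
    if z: "z \<in> E" and M: "infinite M" "homogeneous n (slice z 1) M" for z M
  proof -
    have sol: "\<exists>S. infinite S \<and> homogeneous n (slice w 0) S \<and>
        H (pair (name n (slice w 0)) (indicator N)) = Some (indicator S)"
      if w: "w \<in> E" and N: "infinite N" "homogeneous n (slice w 1) N" for w N
    proof -
      obtain r d where r: "K (name n (slice w 0)) = Some r" "coloring_rep n k r = Some d"
        using K[OF E_Col(1)[OF w]] by blast
      have "homogeneous n (slice w 1) N = homogeneous n d N"
        using D[OF E_Col(1)[OF w] r] w by (intro homogeneous_cong) (simp add: E_def)
      then show ?thesis using H[OF E_Col(1)[OF w] r N(1)] N(2) by simp
    qed
    let ?p = "pair (name n (slice z 0)) (indicator M)"
    obtain S where S: "infinite S" "H ?p = Some (indicator S)"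
      using sol[OF z M] by blast
    \<comment> \<open>The color of one \<open>n\<close>-subset \<open>s\<close> is the color of the
      whole solution, and recognizing \<open>s\<close> inside the solution uses a finite part of the
      oracle.\<close>
    obtain s where s: "finite s" "card s = n" "s \<subseteq> S"
      using infinite_arbitrarily_large[OF S(1)] by blast
    have "computes ?p h [x] 1" if "x \<in> s" for x
      using h[OF S(2), of x] that s(3) by (auto simp: indicator_def split: if_splits)
    from computes_use_finite[OF s(1), of ?p h "\<lambda>_. 1", OF this] obtain m where
      m: "\<And>p' x. \<forall>y<m. p' y = ?p y \<Longrightarrow> x \<in> s \<Longrightarrow> computes p' h [x] 1"
      by blast
    \<comment> \<open>The coordinate \<open>(0, s)\<close> transfers the color of \<open>s\<close>;
      the others fix the part of the name that \<open>H\<close> reads.\<close>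
    let ?G = "insert (0, s) (Pair 0 ` theta n ` {..<m})"
    have hom: "has_homogeneous n (slice z 0 s) (slice w 0)"
      if w: "w \<in> E" and N: "infinite N" "homogeneous n (slice w 1) N" and ag: "agrees ?G z w"
        and NM: "N \<inter> {..m} = M \<inter> {..m}" for w N
    proof -
      let ?p' = "pair (name n (slice w 0)) (indicator N)"
      obtain S' where S': "infinite S'" "homogeneous n (slice w 0) S'" "H ?p' = Some (indicator S')"
        using sol[OF w N] by blast
      have "?p' y = ?p y" if "y < m" for y
      proof -
        have "y div 2 < m" using that by simp
        then have "name n (slice w 0) (y div 2) = name n (slice z 0) (y div 2)"
          using ag by (auto simp: agrees_def name_def slice_def)
        moreover have "y div 2 \<in> N \<inter> {..m} \<longleftrightarrow> y div 2 \<in> M \<inter> {..m}"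
          unfolding NM ..
        then have "y div 2 \<in> N \<longleftrightarrow> y div 2 \<in> M" using \<open>y div 2 < m\<close> by simp
        ultimately show ?thesis by (simp add: pair_def indicator_def)
      qed
      then have 1: "computes ?p' h [x] 1" if "x \<in> s" for x
        using that by (intro m) auto
      have "x \<in> S'" if "x \<in> s" for x
        using computes_deterministic[OF h[OF S'(3), of x] 1[OF that]]
        by (simp only: indicator_eq_1_iff)
      then have "s \<in> nsets S' n" using s by (auto simp: nsets_def)
      moreover have "slice w 0 s = slice z 0 s" using ag by (simp add: agrees_def slice_def)
      ultimately have "\<forall>t\<in>nsets S' n. slice w 0 t = slice z 0 s"
        using S'(2) by (auto simp: homogeneous_def)
      then show ?thesis using S'(1) by (auto simp: has_homogeneous_def)
    qed
    have fin: "finite ?G" by simp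
    show ?thesis
      by (rule exI[of _ "slice z 0 s"], rule exI[of _ ?G], rule exI[of _ m],
          intro conjI ballI allI impI fin) (elim conjE, rule hom)
  qed
  have "selector n l k E"
    unfolding selector_def
    by (intro conjI ballI allI impI compact_E E_Col proj) (assumption | elim conjE, rule commit)+
  then show ?thesis by (rule that)
qed

section \<open>The reduction from fewer to more colors\<close>

lemma computable_Some: "computable Some"
  unfolding computable_def by (intro exI[of _ Query]) (auto intro: computes.Query)

lemma computable_snd: "computable (\<lambda>p. Some (\<lambda>i. p (2 * i + 1)))"
proof -
  \<comment> \<open>The step function receives \<open>m # y # xs\<close>, so \<open>Proj 1\<close>
    is the value obtained so far.\<close>
  let ?double = "PrimRec Zero (Comp Succ [Comp Succ [Proj 1]])"
  have double: "computes p ?double [i] (2 * i)" for p i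
  proof (induction i)
    case 0
    then show ?case by (auto intro: computes.PrimRec_0 computes.Zero)
  next
    case (Suc i)
    have "computes p (Proj 1) [i, 2 * i] ([i, 2 * i] ! 1)" by (rule computes.Proj) simp
    then have "computes p (Comp Succ [Proj 1]) [i, 2 * i] (Suc (2 * i))"
      by (intro computes.Comp[of _ _ _ "[2 * i]"]) (auto intro: computes.Succ)
    then have "computes p (Comp Succ [Comp Succ [Proj 1]]) [i, 2 * i] (Suc (Suc (2 * i)))"
      by (intro computes.Comp[of _ _ _ "[Suc (2 * i)]"]) (auto intro: computes.Succ)
    with Suc show ?case
      using computes.PrimRec_Suc by simp
  qed
  have succ: "computes p (Comp Succ [?double]) [i] (Suc (2 * i))" for p i
    using double by (intro computes.Comp[of _ _ _ "[2 * i]"]) (auto intro: computes.Succ)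
  have "computes p (Comp Query [Comp Succ [?double]]) [i] (p (Suc (2 * i)))" for p i
    using succ by (intro computes.Comp[of _ _ _ "[Suc (2 * i)]"]) (auto intro: computes.Query)
  then show ?thesis unfolding computable_def by auto
qed

text \<open>A \<open>k\<close>-coloring keeps its names and its homogeneous sets when read as a
  \<open>k'\<close>-coloring. So \<open>K\<close> is the identity, and \<open>H\<close> extracts the
  second component of the pair from the odd positions.\<close>

lemma RT_mono:
  assumes n: "n \<ge> 1" and "k \<le> k'"
  shows "RT n k \<le>\<^sub>W RT n k'"
  unfolding weihrauch_le_def
proof (rule exI[of _ "\<lambda>p. Some (\<lambda>i. p (2 * i + 1))"], rule exI[of _ Some], intro conjI allI impI)
  show "computable Some" by (rule computable_Some)
  show "computable (\<lambda>p. Some (\<lambda>i. p (2 * i + 1)))" by (rule computable_snd)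
  fix G assume G: "realizes G (RT n k')"
  have rep: "coloring_rep n k' p = Some c" if "coloring_rep n k p = Some c" for p c
  proof -
    have "colorings n k \<subseteq> colorings n k'"
      unfolding colorings_def using assms(2) by (intro PiE_mono) auto
    then show ?thesis using that by (auto simp: coloring_rep_eq_Some_iff[OF n])
  qed
  show "realizes (\<lambda>p. Option.bind (Some p) (\<lambda>r. Option.bind (G r)
      (\<lambda>s. Some (\<lambda>i. pair p s (2 * i + 1))))) (RT n k)"
    unfolding realizes_RT_iff[OF n]
  proof (intro allI impI)
    fix p c assume "coloring_rep n k p = Some c"
    from rep[OF this] G obtain M where "infinite M" "homogeneous n c M" "G p = Some (indicator M)"
      unfolding realizes_RT_iff[OF n] by blast
    then show "\<exists>M. infinite M \<and> homogeneous n c M \<and> Option.bind (Some p) (\<lambda>r. Option.bind (G r)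
        (\<lambda>s. Some (\<lambda>i. pair p s (2 * i + 1)))) = Some (indicator M)"
      by (intro exI[of _ M]) (simp add: pair_def)
  qed
qed

theorem theorem4p22:
  fixes n k :: nat
  assumes "n \<ge> 1" and "k \<ge> 1"
  shows "RT n k <\<^sub>W RT n (k + 1)"
  unfolding weihrauch_less_def
proof
  show "RT n k \<le>\<^sub>W RT n (k + 1)"
    by (rule RT_mono[OF assms(1)]) simp
  show "\<not> RT n (k + 1) \<le>\<^sub>W RT n k"
  proof
    assume "RT n (k + 1) \<le>\<^sub>W RT n k"
    then obtain E where "selector n (k + 1) k E"
      by (rule weihrauch_le_RT_selector[OF assms(1)])
    then show False using no_selector[OF assms(1)] by simp
  qed
qed

end
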